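(* Let $G=(V,F)$ be a $12$-connected graph on $n$ vertices and let $S\subseteq F$ with $|S|\le 6$. Then $G-S$ is $C_2^1$-rigid, i.e. $F\setminus S$ spans the generic $C_2^1$-cofactor matroid $\mathcal{C}^1_{2,n}$ on $E(K_n)$, where $V$ is identified with $V(K_n)$.
   Context: A graph is $k$-connected if it has at least $k+1$ vertices and remains connected after deleting any fewer than $k$ vertices. Vertices of $K_n$ are $v_1,\dots,v_n$. Choose $p(v_i)=(x_i,y_i)\in\mathbb{R}^2$ with algebraically independent coordinates over $\mathbb{Q}$. $\mathcal{C}^1_{2,n}$ is the row matroid of the $|E(K_n)|\times 3n$ matrix with three columns per vertex. The row of edge $v_iv_j$ with $i<j$ has $D_{ij}=((x_i-x_j)^2,(x_i-x_j)(y_i-y_j),(y_i-y_j)^2)$ in the columns of $v_i$, $-D_{ij}$ in the columns of $v_j$, and zeros elsewhere. A set spans the matroid if its closure is $E(K_n)$. *)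

theory Defs
  imports Complex_Main
begin

text \<open>Vertices of K_n are 0,...,n-1 (v_{i+1} corresponds to i).
  Edges are unordered pairs {i,j} with i \<noteq> j.\<close>

definition Kn_edges :: "nat \<Rightarrow> nat set set" where
  "Kn_edges n = {{i, j} | i j. i < n \<and> j < n \<and> i \<noteq> j}"

definition is_graph :: "nat \<Rightarrow> nat set set \<Rightarrow> bool" where
  "is_graph n F \<longleftrightarrow> F \<subseteq> Kn_edges n"

definition connected_minus :: "nat \<Rightarrow> nat set set \<Rightarrow> nat set \<Rightarrow> bool" where
  "connected_minus n F X \<longleftrightarrow>
     (\<forall>u \<in> {0..<n} - X. \<forall>v \<in> {0..<n} - X.
        (\<lambda>a b. a \<in> {0..<n} - X \<and> b \<in> {0..<n} - X \<and> {a, b} \<in> F)\<^sup>*\<^sup>* u v)"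

definition k_connected :: "nat \<Rightarrow> nat \<Rightarrow> nat set set \<Rightarrow> bool" where
  "k_connected k n F \<longleftrightarrow> k + 1 \<le> n \<and>
     (\<forall>X. X \<subseteq> {0..<n} \<and> card X < k \<longrightarrow> connected_minus n F X)"

text \<open>Algebraic independence over Q of z 0, ..., z (N-1): no nontrivial rational
  polynomial relation. A polynomial is a finite set M of exponent vectors
  (supported on variables < N) with rational coefficients c.\<close>
definition alg_indep :: "nat \<Rightarrow> (nat \<Rightarrow> real) \<Rightarrow> bool" where
  "alg_indep N z \<longleftrightarrow>
     (\<forall>(M :: (nat \<Rightarrow> nat) set) (c :: (nat \<Rightarrow> nat) \<Rightarrow> rat).
        finite M \<and> (\<forall>e\<in>M. \<forall>i. N \<le> i \<longrightarrow> e i = 0) \<and>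
        (\<Sum>e\<in>M. of_rat (c e) * (\<Prod>i<N. z i ^ e i)) = 0
        \<longrightarrow> (\<forall>e\<in>M. c e = 0))"

definition generic_config :: "nat \<Rightarrow> (nat \<Rightarrow> real) \<Rightarrow> (nat \<Rightarrow> real) \<Rightarrow> bool" where
  "generic_config n x y \<longleftrightarrow> alg_indep (2 * n) (\<lambda>i. if i < n then x i else y (i - n))"

definition Dvec :: "(nat \<Rightarrow> real) \<Rightarrow> (nat \<Rightarrow> real) \<Rightarrow> nat \<Rightarrow> nat \<Rightarrow> nat \<Rightarrow> real" where
  "Dvec x y i j k =
     (if k = 0 then (x i - x j)^2
      else if k = 1 then (x i - x j) * (y i - y j)
      else (y i - y j)^2)"

text \<open>Row of the cofactor matrix for edge e = {i,j}, i < j; columns of vertex v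
  are 3v, 3v+1, 3v+2 (columns indexed by nat, zero outside 0..3n-1).\<close>
definition cof_row :: "(nat \<Rightarrow> real) \<Rightarrow> (nat \<Rightarrow> real) \<Rightarrow> nat set \<Rightarrow> nat \<Rightarrow> real" where
  "cof_row x y e col =
     (let i = Min e; j = Max e; v = col div 3; k = col mod 3 in
      if v = i then Dvec x y i j k
      else if v = j then - Dvec x y i j k
      else 0)"

definition in_cof_closure :: "(nat \<Rightarrow> real) \<Rightarrow> (nat \<Rightarrow> real) \<Rightarrow> nat set set \<Rightarrow> nat set \<Rightarrow> bool" where
  "in_cof_closure x y X e \<longleftrightarrow>
     (\<exists>c :: nat set \<Rightarrow> real. cof_row x y e = (\<lambda>col. \<Sum>f\<in>X. c f * cof_row x y f col))"

definition cof_spans :: "nat \<Rightarrow> (nat \<Rightarrow> real) \<Rightarrow> (nat \<Rightarrow> real) \<Rightarrow> nat set set \<Rightarrow> bool" where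
  "cof_spans n x y X \<longleftrightarrow> X \<subseteq> Kn_edges n \<and> (\<forall>e \<in> Kn_edges n. in_cof_closure x y X e)"

end

theory Submission
  imports Defs
begin

text \<open>Let \<open>H\<close> be the closure of \<open>F - S\<close>, suppose that it is not complete, and let \<open>W\<close> be a smallest
  vertex set on which \<open>H \<union> S\<close> is still 12-connected and \<open>H\<close> not complete. Following Villanyi's
  argument for \<open>d(d+1)\<close>-connected graphs, insert the vertices of \<open>W\<close> in a uniformly random order.
  A new vertex with \<open>k\<close> earlier \<open>H\<close>-neighbours raises the rank by at least \<open>min k 3\<close>, and by at least 4
  if \<open>k \<ge> 4\<close> and these neighbours are not a clique of \<open>H\<close> (1-extension). Two cliques of \<open>H\<close> sharing
  three vertices span a clique, so few \<open>k\<close>-subsets of a neighbourhood are cliques; hence a vertex with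
  \<open>D\<close> neighbours in \<open>H\<close> contributes on average at least \<open>7/2 - 6/D\<close>, or \<open>3 - 6/(D+1)\<close> if its
  neighbourhood is a clique. By minimality a vertex of the latter kind meets \<open>S\<close>, and as
  \<open>D + s \<ge> 12\<close> for a vertex meeting \<open>s\<close> edges of \<open>S\<close>, the contribution is at least \<open>3 - s/2\<close> in both
  cases. Summing up, \<open>H\<close> has rank at least \<open>3|W| - 6\<close> on \<open>W\<close>, which is the largest rank possible, although
  \<open>H\<close> is closed and not complete: a contradiction.\<close>

section \<open>Linear independence and generic points\<close>

text \<open>The family is indexed, so equal rows at different indices count as dependent; the ground
  set consists of edges, not of vectors.\<close>

definition lin_indep :: "'i set \<Rightarrow> ('i \<Rightarrow> 'k \<Rightarrow> real) \<Rightarrow> bool" where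
  "lin_indep I A \<longleftrightarrow> (\<forall>c. (\<forall>k. (\<Sum>i\<in>I. c i * A i k) = 0) \<longrightarrow> (\<forall>i\<in>I. c i = 0))"

lemma lin_indepI:
  "(\<And>c i. (\<And>k. (\<Sum>i\<in>I. c i * A i k) = 0) \<Longrightarrow> i \<in> I \<Longrightarrow> c i = 0) \<Longrightarrow> lin_indep I A"
  unfolding lin_indep_def by blast

lemma lin_indepD:
  "lin_indep I A \<Longrightarrow> (\<And>k. (\<Sum>i\<in>I. c i * A i k) = 0) \<Longrightarrow> i \<in> I \<Longrightarrow> c i = 0"
  unfolding lin_indep_def by blast

lemma lin_indep_mono:
  assumes "lin_indep I A" "J \<subseteq> I" "finite I"
  shows "lin_indep J A"
proof (rule lin_indepI)
  fix c i assume c: "\<And>k. (\<Sum>i\<in>J. c i * A i k) = 0" and i: "i \<in> J"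
  let ?c = "\<lambda>i. if i \<in> J then c i else 0"
  have "(\<Sum>i\<in>I. ?c i * A i k) = 0" for k
  proof -
    have "(\<Sum>i\<in>I. ?c i * A i k) = (\<Sum>i\<in>J. ?c i * A i k)"
      using assms by (intro sum.mono_neutral_right) auto
    then show ?thesis using c[of k] by simp
  qed
  then have "?c i = 0" using lin_indepD[OF assms(1), of ?c i] i assms(2) by blast
  then show "c i = 0" using i by simp
qed

lemma lin_indep_cong:
  "(\<And>i. i \<in> I \<Longrightarrow> A i = B i) \<Longrightarrow> lin_indep I A \<longleftrightarrow> lin_indep I B"
  unfolding lin_indep_def by simp

text \<open>One elimination step with pivot \<open>A i k\<close>. A relation among the new rows is a
  relation among the old ones scaled by the pivot, with row \<open>i\<close> absorbing the
  remainder; no division occurs, so polynomial entries stay polynomial.\<close>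

lemma lin_indep_eliminate:
  assumes "finite I" "i \<in> I" "A i k \<noteq> 0"
  shows "lin_indep I A \<longleftrightarrow> lin_indep (I - {i}) (\<lambda>j l. A i k * A j l - A j k * A i l)"
    (is "_ \<longleftrightarrow> lin_indep ?J ?A")
proof -
  have split: "(\<Sum>j\<in>I. h j) = h i + (\<Sum>j\<in>?J. h j)" for h :: "_ \<Rightarrow> real"
    using assms by (simp add: sum.remove)
  have elim: "(\<Sum>j\<in>?J. c j * ?A j l) = A i k * (\<Sum>j\<in>?J. c j * A j l) - (\<Sum>j\<in>?J. c j * A j k) * A i l"
    for c l by (simp add: sum_distrib_left sum_distrib_right sum_subtractf[symmetric] algebra_simps)
  show ?thesis
  proof
    assume I: "lin_indep I A"
    show "lin_indep ?J ?A"
    proof (rule lin_indepI)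
      fix c j assume c: "\<And>l. (\<Sum>j\<in>?J. c j * ?A j l) = 0" and j: "j \<in> ?J"
      let ?c = "\<lambda>j. if j = i then - (\<Sum>j\<in>?J. c j * A j k) else A i k * c j"
      have "(\<Sum>j\<in>I. ?c j * A j l) = 0" for l
      proof -
        have "(\<Sum>j\<in>?J. ?c j * A j l) = A i k * (\<Sum>j\<in>?J. c j * A j l)"
          unfolding sum_distrib_left by (rule sum.cong) auto
        then show ?thesis using c[of l] elim[of c l] split[of "\<lambda>j. ?c j * A j l"] by simp
      qed
      then have "?c j = 0" using lin_indepD[OF I, of ?c j] j by blast
      then show "c j = 0" using j assms by simp
    qed
  next
    assume J: "lin_indep ?J ?A"
    show "lin_indep I A"
    proof (rule lin_indepI)
      fix c j assume c: "\<And>l. (\<Sum>j\<in>I. c j * A j l) = 0" and j: "j \<in> I"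
      have J0: "(\<Sum>j\<in>?J. c j * A j l) = - c i * A i l" for l
        using c[of l] split[of "\<lambda>j. c j * A j l"] by simp
      have "(\<Sum>j\<in>?J. c j * ?A j l) = 0" for l
        unfolding elim J0 by simp
      then have z: "c j = 0" if "j \<in> ?J" for j using lin_indepD[OF J, of c j] that by blast
      then have "c i * A i k = 0" using J0[of k] by simp
      then show "c j = 0" using z j assms(3) by (cases "j = i") auto
    qed
  qed
qed

lemma lin_indep_nonzero_row:
  assumes "lin_indep I A" "finite I" "i \<in> I"
  obtains k where "A i k \<noteq> 0"
proof -
  have "\<exists>k. A i k \<noteq> 0"
  proof (rule ccontr)
    assume "\<nexists>k. A i k \<noteq> 0"
    then have "(\<Sum>j\<in>I. (if j = i then 1 else 0) * A j k) = 0" for k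
      by (intro sum.neutral) auto
    from lin_indepD[OF assms(1) this assms(3)] show False by simp
  qed
  then show ?thesis using that by blast
qed

text \<open>Elimination clears the pivot column, so each induction step removes one row and one
  column of the common support.\<close>

lemma lin_indep_card_le:
  assumes "finite I" "finite C" "lin_indep I A" "\<And>i k. i \<in> I \<Longrightarrow> k \<notin> C \<Longrightarrow> A i k = 0"
  shows "card I \<le> card C"
  using assms
proof (induction "card I" arbitrary: I C A)
  case 0
  then show ?case by simp
next
  case (Suc m)
  then obtain i where i: "i \<in> I" by fastforce
  obtain k where k: "A i k \<noteq> 0" using lin_indep_nonzero_row[OF Suc.prems(3,1) i] .
  have kC: "k \<in> C" using Suc.prems(4) i k by blast
  have "card (I - {i}) \<le> card (C - {k})"
  proof (rule Suc.hyps)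
    show "m = card (I - {i})" using Suc.hyps(2) i Suc.prems(1) by simp
    show "lin_indep (I - {i}) (\<lambda>j l. A i k * A j l - A j k * A i l)"
      using lin_indep_eliminate[of I i A k, OF Suc.prems(1) i k] Suc.prems(3) by simp
  qed (use Suc.prems i in auto)
  then show ?case using i kC Suc.prems(1,2)
    by (metis Suc_le_mono card_Suc_Diff1)
qed

text \<open>Gaussian elimination without divisions keeps the entries in \<open>R\<close>.\<close>
lemma lin_indep_transfer:
  fixes A :: "'z \<Rightarrow> 'i \<Rightarrow> 'k \<Rightarrow> real"
  assumes "finite I" "\<And>i k. i \<in> I \<Longrightarrow> (\<lambda>z. A z i k) \<in> R"
    and mult: "\<And>f g. f \<in> R \<Longrightarrow> g \<in> R \<Longrightarrow> (\<lambda>z. f z * g z) \<in> R"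
    and diff: "\<And>f g. f \<in> R \<Longrightarrow> g \<in> R \<Longrightarrow> (\<lambda>z. f z - g z) \<in> R"
    and gen: "\<And>f. f \<in> R \<Longrightarrow> f q \<noteq> 0 \<Longrightarrow> f p \<noteq> 0"
    and "lin_indep I (A q)"
  shows "lin_indep I (A p)"
  using assms(1,2,6)
proof (induction "card I" arbitrary: I A)
  case 0
  then show ?case by (simp add: lin_indep_def)
next
  case (Suc m)
  then obtain i where i: "i \<in> I" by fastforce
  obtain k where k: "A q i k \<noteq> 0" using lin_indep_nonzero_row[OF Suc.prems(3,1) i] .
  \<comment> \<open>By \<open>gen\<close>, the pivot chosen at \<open>q\<close> is also a pivot at
    \<open>p\<close>, so the same elimination runs at both points.\<close>
  have k': "A p i k \<noteq> 0" using gen[of "\<lambda>z. A z i k"] Suc.prems(2) i k by blast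
  let ?A = "\<lambda>z j l. A z i k * A z j l - A z j k * A z i l"
  have "lin_indep (I - {i}) (?A p)"
  proof (rule Suc.hyps)
    show "m = card (I - {i})" using Suc.hyps(2) i Suc.prems(1) by simp
    show "lin_indep (I - {i}) (?A q)"
      using lin_indep_eliminate[of I i "A q" k, OF Suc.prems(1) i k] Suc.prems(3) by simp
    show "(\<lambda>z. ?A z j l) \<in> R" if "j \<in> I - {i}" for j l
      using that i by (intro mult diff Suc.prems(2)) auto
  qed (use Suc.prems in auto)
  then show ?case using lin_indep_eliminate[of I i "A p" k, OF Suc.prems(1) i k'] by simp
qed

section \<open>Rational polynomial functions and algebraic independence\<close>

definition rat_poly_fun :: "nat \<Rightarrow> ((nat \<Rightarrow> real) \<Rightarrow> real) \<Rightarrow> bool" where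
  "rat_poly_fun N f \<longleftrightarrow> (\<exists>(M :: (nat \<Rightarrow> nat) set) c. finite M \<and> (\<forall>e\<in>M. \<forall>i. N \<le> i \<longrightarrow> e i = 0) \<and>
     f = (\<lambda>z. \<Sum>e\<in>M. of_rat (c e) * (\<Prod>i<N. z i ^ e i)))"

text \<open>Terms with the same exponent vector are collected, because \<open>\<epsilon>\<close> may
  repeat values, as happens when a product of polynomials is expanded.\<close>

lemma rat_poly_fun_sum:
  assumes "finite J" "\<And>j i. j \<in> J \<Longrightarrow> N \<le> i \<Longrightarrow> \<epsilon> j i = 0"
  shows "rat_poly_fun N (\<lambda>z. \<Sum>j\<in>J. of_rat (d j) * (\<Prod>i<N. z i ^ \<epsilon> j i))"
  unfolding rat_poly_fun_def
proof (intro exI conjI)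
  let ?c = "\<lambda>e. \<Sum>j | j \<in> J \<and> \<epsilon> j = e. d j"
  show "finite (\<epsilon> ` J)" "\<forall>e\<in>\<epsilon> ` J. \<forall>i. N \<le> i \<longrightarrow> e i = 0" using assms by auto
  have "(\<Sum>j\<in>J. of_rat (d j) * (\<Prod>i<N. z i ^ \<epsilon> j i))
      = (\<Sum>e\<in>\<epsilon> ` J. of_rat (?c e) * (\<Prod>i<N. z i ^ e i))" for z :: "nat \<Rightarrow> real"
    unfolding sum.image_gen[OF assms(1), of _ \<epsilon>] of_rat_sum sum_distrib_right
    by (intro sum.cong refl) auto
  then show "(\<lambda>z. \<Sum>j\<in>J. of_rat (d j) * (\<Prod>i<N. z i ^ \<epsilon> j i))
      = (\<lambda>z :: nat \<Rightarrow> real. \<Sum>e\<in>\<epsilon> ` J. of_rat (?c e) * (\<Prod>i<N. z i ^ e i))" by blast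
qed

lemma rat_poly_fun_const: "rat_poly_fun N (\<lambda>z. of_rat a)"
  using rat_poly_fun_sum[of "{()}" N "\<lambda>_ _. 0" "\<lambda>_. a"] by simp

lemma rat_poly_fun_var:
  assumes "v < N" shows "rat_poly_fun N (\<lambda>z. z v)"
proof -
  have "(\<Prod>i<N. z i ^ (if i = v then 1 else 0)) = z v" for z :: "nat \<Rightarrow> real"
  proof -
    have "(\<Prod>i<N. z i ^ (if i = v then 1 else 0)) = (\<Prod>i<N. if i = v then z i else 1)"
      by (rule prod.cong) auto
    then show ?thesis using assms by simp
  qed
  then show ?thesis
    using rat_poly_fun_sum[of "{()}" N "\<lambda>_ i. if i = v then 1 else 0" "\<lambda>_. 1"] assms by simp
qed

lemma rat_poly_fun_add:
  assumes "rat_poly_fun N f" "rat_poly_fun N g"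
  shows "rat_poly_fun N (\<lambda>z. f z + g z)"
proof -
  from assms(1) obtain M c where f: "finite M" "\<forall>e\<in>M. \<forall>i. N \<le> i \<longrightarrow> e i = 0"
      "f = (\<lambda>z. \<Sum>e\<in>M. of_rat (c e) * (\<Prod>i<N. z i ^ e i))"
    unfolding rat_poly_fun_def by blast
  from assms(2) obtain M' c' where g: "finite M'" "\<forall>e\<in>M'. \<forall>i. N \<le> i \<longrightarrow> e i = 0"
      "g = (\<lambda>z. \<Sum>e\<in>M'. of_rat (c' e) * (\<Prod>i<N. z i ^ e i))"
    unfolding rat_poly_fun_def by blast
  let ?e = "case_sum id id" and ?c = "case_sum c c'"
  have "rat_poly_fun N (\<lambda>z. \<Sum>j\<in>M <+> M'. of_rat (?c j) * (\<Prod>i<N. z i ^ ?e j i))"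
    by (rule rat_poly_fun_sum) (use f g in auto)
  then show ?thesis using f g by (simp add: sum.Plus)
qed

lemma rat_poly_fun_mult:
  assumes "rat_poly_fun N f" "rat_poly_fun N g"
  shows "rat_poly_fun N (\<lambda>z. f z * g z)"
proof -
  from assms(1) obtain M c where f: "finite M" "\<forall>e\<in>M. \<forall>i. N \<le> i \<longrightarrow> e i = 0"
      "f = (\<lambda>z. \<Sum>e\<in>M. of_rat (c e) * (\<Prod>i<N. z i ^ e i))"
    unfolding rat_poly_fun_def by blast
  from assms(2) obtain M' c' where g: "finite M'" "\<forall>e\<in>M'. \<forall>i. N \<le> i \<longrightarrow> e i = 0"
      "g = (\<lambda>z. \<Sum>e\<in>M'. of_rat (c' e) * (\<Prod>i<N. z i ^ e i))"
    unfolding rat_poly_fun_def by blast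
  let ?e = "\<lambda>(e, e') i. e i + e' i :: nat" and ?c = "\<lambda>(e, e'). c e * c' e'"
  have "f z * g z = (\<Sum>j\<in>M \<times> M'. of_rat (?c j) * (\<Prod>i<N. z i ^ ?e j i))" for z
    unfolding f(3) g(3) sum_product sum.cartesian_product
    by (rule sum.cong) (auto simp: of_rat_mult power_add prod.distrib)
  moreover have "rat_poly_fun N (\<lambda>z. \<Sum>j\<in>M \<times> M'. of_rat (?c j) * (\<Prod>i<N. z i ^ ?e j i))"
    by (rule rat_poly_fun_sum) (use f g in auto)
  ultimately show ?thesis by presburger
qed

lemma rat_poly_fun_diff:
  assumes "rat_poly_fun N f" "rat_poly_fun N g"
  shows "rat_poly_fun N (\<lambda>z. f z - g z)"
  using rat_poly_fun_add[OF assms(1) rat_poly_fun_mult[OF rat_poly_fun_const[of N "-1"] assms(2)]]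
  by simp

text \<open>A function that is nonzero somewhere has a nonzero coefficient. Thus a generic
  non-vanishing claim reduces to exhibiting one convenient point \<open>w\<close>.\<close>

lemma alg_indep_nonzero:
  assumes "alg_indep N z" "rat_poly_fun N f" "f w \<noteq> 0"
  shows "f z \<noteq> 0"
proof
  assume "f z = 0"
  from assms(2) obtain M c where f: "finite M" "\<forall>e\<in>M. \<forall>i. N \<le> i \<longrightarrow> e i = 0"
      "f = (\<lambda>z. \<Sum>e\<in>M. of_rat (c e) * (\<Prod>i<N. z i ^ e i))"
    unfolding rat_poly_fun_def by blast
  have "\<forall>e\<in>M. c e = 0" using assms(1) f \<open>f z = 0\<close> unfolding alg_indep_def by blast
  then have "f w = 0" unfolding f(3) by simp
  with assms(3) show False by simp
qed

section \<open>Extensions in the cofactor matroid\<close>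

text \<open>The sign that corrects for \<open>cof_row\<close> listing the smaller endpoint first;
  with it an edge can be written from either end.\<close>

definition sgn_pair :: "nat \<Rightarrow> nat \<Rightarrow> real" where
  "sgn_pair a b = (if a < b then 1 else - 1)"

lemma sgn_pair_simps [simp]: "sgn_pair a b \<noteq> 0" "sgn_pair a b * sgn_pair a b = 1"
  by (auto simp: sgn_pair_def)

lemma Dvec_commute: "Dvec x y i j k = Dvec x y j i k"
  unfolding Dvec_def by (auto simp: power2_eq_square algebra_simps)

lemma cof_row_pair:
  assumes "a \<noteq> b"
  shows "cof_row x y {a, b} col = sgn_pair a b *
    (if col div 3 = a then Dvec x y a b (col mod 3)
     else if col div 3 = b then - Dvec x y a b (col mod 3) else 0)"
  using assms Dvec_commute[of x y a b]
  by (cases "a < b") (auto simp: cof_row_def Let_def sgn_pair_def min_def max_def)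

lemma Kn_edgesE:
  assumes "e \<in> Kn_edges n"
  obtains a b where "e = {a, b}" "a \<noteq> b" "a < n" "b < n"
  using assms unfolding Kn_edges_def by blast

lemma Kn_edges_pair [simp]: "{a, b} \<in> Kn_edges n \<longleftrightarrow> a \<noteq> b \<and> a < n \<and> b < n"
  unfolding Kn_edges_def by (auto simp: doubleton_eq_iff)

lemma finite_Kn_edges: "finite (Kn_edges n)"
proof (rule finite_subset)
  show "Kn_edges n \<subseteq> Pow {..<n}" unfolding Kn_edges_def by auto
qed simp

lemma cof_row_notin:
  assumes "e \<in> Kn_edges n" "col div 3 \<notin> e"
  shows "cof_row x y e col = 0"
  using assms by (elim Kn_edgesE) (auto simp: cof_row_pair)

lemma cof_row_cong:
  assumes "e \<in> Kn_edges n" "\<And>i. i \<in> e \<Longrightarrow> x i = x' i" "\<And>i. i \<in> e \<Longrightarrow> y i = y' i"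
  shows "cof_row x y e = cof_row x' y' e"
  using assms by (elim Kn_edgesE) (auto simp: cof_row_pair Dvec_def)

text \<open>A configuration is packed into one vector: variable \<open>i\<close> is the x-coordinate
  of vertex \<open>i\<close> and variable \<open>n + i\<close> its y-coordinate.\<close>

lemma rat_poly_fun_Dvec:
  assumes "i < n" "j < n"
  shows "rat_poly_fun (2 * n) (\<lambda>z. Dvec z (\<lambda>i. z (n + i)) i j k)"
  unfolding Dvec_def power2_eq_square
  using assms by (cases "k = 0"; cases "k = 1")
    (simp_all add: rat_poly_fun_mult rat_poly_fun_diff rat_poly_fun_var)

lemma rat_poly_fun_cof_row:
  assumes "e \<in> Kn_edges n"
  shows "rat_poly_fun (2 * n) (\<lambda>z. cof_row z (\<lambda>i. z (n + i)) e col)"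
proof -
  obtain a b where e: "e = {a, b}" "a \<noteq> b" "a < n" "b < n" using assms by (elim Kn_edgesE)
  have m: "rat_poly_fun (2 * n) (\<lambda>z. - Dvec z (\<lambda>i. z (n + i)) a b (col mod 3))"
    using rat_poly_fun_diff[OF rat_poly_fun_const[of _ 0] rat_poly_fun_Dvec[OF e(3,4)]] by simp
  show ?thesis
    using m rat_poly_fun_Dvec[OF e(3,4), of "col mod 3"] rat_poly_fun_const[of "2 * n" 0]
    unfolding e(1) cof_row_pair[OF e(2)]
    by (cases "col div 3 = a"; cases "col div 3 = b"; cases "a < b") (simp_all add: sgn_pair_def)
qed

lemma generic_config_nonzero:
  assumes "generic_config n x y" "rat_poly_fun (2 * n) f" "f w \<noteq> 0"
  shows "f (\<lambda>i. if i < n then x i else y (i - n)) \<noteq> 0"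
  using assms alg_indep_nonzero unfolding generic_config_def by blast

text \<open>The row entries are polynomials in the coordinates, so independence at a single
  position, however special, passes to the generic one.\<close>

lemma generic_config_lin_indep:
  assumes "generic_config n x y" "E \<subseteq> Kn_edges n" "lin_indep E (cof_row x' y')"
  shows "lin_indep E (cof_row x y)"
proof -
  let ?z = "\<lambda>x y i. if i < n then x i else y (i - n)"
  let ?A = "\<lambda>z. cof_row z (\<lambda>i. z (n + i))"
  have rows: "?A (?z x y) e = cof_row x y e" if "e \<in> E" for e and x y :: "nat \<Rightarrow> real"
    using that assms(2) by (intro cof_row_cong[of e n]) (auto elim!: Kn_edgesE)
  have "lin_indep E (?A (?z x y))"
  proof (rule lin_indep_transfer[where R = "{f. rat_poly_fun (2 * n) f}" and q = "?z x' y'"])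
    show "finite E" using assms(2) finite_Kn_edges finite_subset by blast
    show "lin_indep E (?A (?z x' y'))"
      using assms(3) lin_indep_cong[of E "?A (?z x' y')" "cof_row x' y'"] rows by simp
    show "f (?z x y) \<noteq> 0" if "f \<in> {f. rat_poly_fun (2 * n) f}" "f (?z x' y') \<noteq> 0" for f
      using that generic_config_nonzero[OF assms(1)] by simp
  qed (use assms(2) in \<open>auto intro!: rat_poly_fun_cof_row rat_poly_fun_mult rat_poly_fun_diff\<close>)
  then show ?thesis using lin_indep_cong[of E "?A (?z x y)" "cof_row x y"] rows by simp
qed

lemma generic_config_distinct:
  assumes "generic_config n x y" "i < n" "j < n" "i \<noteq> j"
  shows "x i \<noteq> x j" "y i \<noteq> y j"
proof -
  have "rat_poly_fun (2 * n) (\<lambda>z. z i - z j)" "rat_poly_fun (2 * n) (\<lambda>z. z (n + i) - z (n + j))"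
    using assms by (auto intro!: rat_poly_fun_diff rat_poly_fun_var)
  \<comment> \<open>Test point: vertex \<open>i\<close> at (1,1), all others at the origin.\<close>
  from this[THEN generic_config_nonzero[OF assms(1)], of "\<lambda>k. if k = i \<or> k = n + i then 1 else 0"]
  show "x i \<noteq> x j" "y i \<noteq> y j" using assms by auto
qed

section \<open>General position and squares of directions\<close>

definition cross :: "real \<Rightarrow> real \<Rightarrow> real \<Rightarrow> real \<Rightarrow> real" where
  "cross u w u' w' = u * w' - u' * w"

lemma generic_config_noncollinear:
  assumes "generic_config n x y" "i < n" "j < n" "k < n" "i \<noteq> j" "i \<noteq> k" "j \<noteq> k"
  shows "cross (x i - x j) (y i - y j) (x i - x k) (y i - y k) \<noteq> 0"
proof -
  let ?f = "\<lambda>z. cross (z i - z j) (z (n + i) - z (n + j)) (z i - z k) (z (n + i) - z (n + k))"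
  have "rat_poly_fun (2 * n) ?f"
    unfolding cross_def using assms
    by (auto intro!: rat_poly_fun_diff rat_poly_fun_mult rat_poly_fun_var)
  \<comment> \<open>Test point: \<open>j\<close> at (1,0), \<open>k\<close> at (0,1), all others at
    the origin.\<close>
  from generic_config_nonzero[OF assms(1) this, of "\<lambda>l. if l = j \<or> l = n + k then 1 else 0"]
  show ?thesis using assms by (auto simp: cross_def)
qed

text \<open>Doubling both vectors clears the denominators. The polynomial is nonzero when
  \<open>c\<close> is at (1,0), \<open>d\<close> at (0,1) and \<open>a\<close>, \<open>b\<close> are
  at the origin.\<close>

lemma generic_config_midpoint_noncollinear:
  assumes "generic_config n x y" "distinct [a, b, c, d]" "{a, b, c, d} \<subseteq> {..<n}"
    and mx: "mx = (x a + x b) / 2" and my: "my = (y a + y b) / 2"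
  shows "cross (mx - x c) (my - y c) (mx - x d) (my - y d) \<noteq> 0"
proof -
  let ?f = "\<lambda>z. cross (z a + z b - (z c + z c)) (z (n + a) + z (n + b) - (z (n + c) + z (n + c)))
     (z a + z b - (z d + z d)) (z (n + a) + z (n + b) - (z (n + d) + z (n + d)))"
  have "rat_poly_fun (2 * n) ?f"
    unfolding cross_def using assms(2,3)
    by (intro rat_poly_fun_add rat_poly_fun_diff rat_poly_fun_mult rat_poly_fun_var) auto
  from generic_config_nonzero[OF assms(1) this, of "\<lambda>l. if l = c \<or> l = n + d then 1 else 0"]
  have "cross (x a + x b - (x c + x c)) (y a + y b - (y c + y c))
     (x a + x b - (x d + x d)) (y a + y b - (y d + y d)) \<noteq> 0"
    using assms(2,3) by (auto simp: cross_def)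
  then show ?thesis by (auto simp: cross_def mx my field_simps)
qed

text \<open>The quadratic form vanishing on the second and the third direction isolates \<open>c1\<close>.\<close>
lemma conic_coeff_zero:
  fixes u1 :: real
  assumes "c1 * u1^2 + c2 * u2^2 + c3 * u3^2 = 0"
    and "c1 * (u1 * w1) + c2 * (u2 * w2) + c3 * (u3 * w3) = 0"
    and "c1 * w1^2 + c2 * w2^2 + c3 * w3^2 = 0"
    and "cross u1 w1 u2 w2 \<noteq> 0" "cross u1 w1 u3 w3 \<noteq> 0"
  shows "c1 = 0"
proof -
  have "c1 * (cross u1 w1 u2 w2 * cross u1 w1 u3 w3)
      = w2 * w3 * (c1 * u1^2 + c2 * u2^2 + c3 * u3^2)
        - (w2 * u3 + u2 * w3) * (c1 * (u1 * w1) + c2 * (u2 * w2) + c3 * (u3 * w3))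
        + u2 * u3 * (c1 * w1^2 + c2 * w2^2 + c3 * w3^2)"
    unfolding cross_def by algebra
  then show ?thesis using assms by simp
qed

text \<open>The hypotheses are symmetric in the three directions, so \<open>conic_coeff_zero\<close>
  treats each coefficient in turn. This is why three edges at a vertex in general position are
  independent in the columns of that vertex.\<close>

lemma conic_independent:
  fixes u1 :: real
  assumes "c1 * u1^2 + c2 * u2^2 + c3 * u3^2 = 0"
    and "c1 * (u1 * w1) + c2 * (u2 * w2) + c3 * (u3 * w3) = 0"
    and "c1 * w1^2 + c2 * w2^2 + c3 * w3^2 = 0"
    and "cross u1 w1 u2 w2 \<noteq> 0" "cross u1 w1 u3 w3 \<noteq> 0" "cross u2 w2 u3 w3 \<noteq> 0"
  shows "c1 = 0 \<and> c2 = 0 \<and> c3 = 0"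
proof -
  have s: "cross a b c d \<noteq> 0 \<longleftrightarrow> cross c d a b \<noteq> 0" for a b c d
    by (auto simp: cross_def mult.commute)
  have "c1 = 0" by (rule conic_coeff_zero[OF assms(1-5)])
  moreover have "c2 = 0"
    by (rule conic_coeff_zero[of c2 u2 c1 u1 c3 u3 w2 w1 w3]) (use assms s in auto)
  moreover have "c3 = 0"
    by (rule conic_coeff_zero[of c3 u3 c1 u1 c2 u2 w3 w1 w2]) (use assms s in auto)
  ultimately show ?thesis by blast
qed

section \<open>Adding a vertex of degree three or four\<close>

text \<open>Edges of \<open>B\<close> avoid \<open>v\<close>, so the columns of \<open>v\<close> see
  only the star; a dependence restricts there to one among the vectors
  \<open>Dvec x y v a\<close>.\<close>

lemma star_sum_at_centre:
  assumes "B \<subseteq> Kn_edges n" "\<And>e. e \<in> B \<Longrightarrow> v \<notin> e" "finite A" "v \<notin> A" "k < 3"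
  shows "(\<Sum>e\<in>B \<union> (\<lambda>a. {v, a}) ` A. c e * cof_row x y e (3 * v + k))
    = (\<Sum>a\<in>A. c {v, a} * sgn_pair v a * Dvec x y v a k)"
proof -
  have inj: "inj_on (\<lambda>a. {v, a}) A" by (auto simp: inj_on_def doubleton_eq_iff)
  have "finite B" using assms(1) finite_Kn_edges finite_subset by blast
  then have "(\<Sum>e\<in>B \<union> (\<lambda>a. {v, a}) ` A. c e * cof_row x y e (3 * v + k))
     = (\<Sum>e\<in>B. c e * cof_row x y e (3 * v + k))
       + (\<Sum>e\<in>(\<lambda>a. {v, a}) ` A. c e * cof_row x y e (3 * v + k))"
    using assms by (intro sum.union_disjoint) auto
  moreover have "(\<Sum>e\<in>B. c e * cof_row x y e (3 * v + k)) = 0"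
    using assms by (intro sum.neutral ballI) (auto simp: cof_row_notin)
  moreover have "(\<Sum>e\<in>(\<lambda>a. {v, a}) ` A. c e * cof_row x y e (3 * v + k))
     = (\<Sum>a\<in>A. c {v, a} * sgn_pair v a * Dvec x y v a k)"
  proof -
    have "cof_row x y {v, a} (3 * v + k) = sgn_pair v a * Dvec x y v a k" if "a \<in> A" for a
    proof -
      have "v \<noteq> a" using that assms(4) by blast
      then show ?thesis using assms(5) by (simp add: cof_row_pair)
    qed
    then show ?thesis unfolding sum.reindex[OF inj] by (simp add: mult.assoc)
  qed
  ultimately show ?thesis by simp
qed

text \<open>Block triangular argument: the columns of \<open>v\<close> force the star coefficients
  to vanish, and what remains is a relation on \<open>B\<close>.\<close>

lemma lin_indep_star:
  assumes B: "B \<subseteq> Kn_edges n" "\<And>e. e \<in> B \<Longrightarrow> v \<notin> e" "lin_indep B (cof_row x y)"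
    and A: "finite A" "v \<notin> A"
    and ind: "\<And>d a. (\<And>k. k < 3 \<Longrightarrow> (\<Sum>a\<in>A. d a * Dvec x y v a k) = 0) \<Longrightarrow> a \<in> A \<Longrightarrow> d a = 0"
  shows "lin_indep (B \<union> (\<lambda>a. {v, a}) ` A) (cof_row x y)"
proof (rule lin_indepI)
  let ?S = "(\<lambda>a. {v, a}) ` A"
  fix c e assume c: "\<And>k. (\<Sum>e\<in>B \<union> ?S. c e * cof_row x y e k) = 0" and e: "e \<in> B \<union> ?S"
  have "(\<Sum>a\<in>A. c {v, a} * sgn_pair v a * Dvec x y v a k) = 0" if "k < 3" for k
    using star_sum_at_centre[OF B(1,2) A that, where c = c and x = x and y = y] unfolding c by (rule sym)
  then have cA: "c {v, a} * sgn_pair v a = 0" if "a \<in> A" for a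
    using ind[of "\<lambda>a. c {v, a} * sgn_pair v a"] that by blast
  have "(\<Sum>e\<in>B. c e * cof_row x y e k) = (\<Sum>e\<in>B \<union> ?S. c e * cof_row x y e k)" for k
    using cA A B(1) finite_Kn_edges by (intro sum.mono_neutral_left) (auto intro: finite_subset)
  then have "c e = 0" if "e \<in> B" using lin_indepD[OF B(3), of c e] c that by simp
  then show "c e = 0" using e cA by auto
qed

text \<open>This is the 0-extension. The neighbour set is padded to exactly three vertices, for
  which \<open>conic_independent\<close> applies, and the extra edges are then dropped.\<close>

lemma lin_indep_three_star:
  assumes gen: "generic_config n x y" and "4 \<le> n"
    and B: "B \<subseteq> Kn_edges n" "\<And>e. e \<in> B \<Longrightarrow> v \<notin> e" "lin_indep B (cof_row x y)"
    and A: "A \<subseteq> {..<n}" "v \<notin> A" "card A \<le> 3" "v < n"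
  shows "lin_indep (B \<union> (\<lambda>a. {v, a}) ` A) (cof_row x y)"
proof -
  have "finite A" using A finite_subset by blast
  have "3 - card A \<le> card ({..<n} - {v} - A)"
    using A \<open>4 \<le> n\<close> by (subst card_Diff_subset) (auto intro: finite_subset)
  then obtain C where C: "C \<subseteq> {..<n} - {v} - A" "card C = 3 - card A" "finite C"
    by (metis obtain_subset_with_card_n)
  have "card (A \<union> C) = 3" using C A \<open>finite A\<close> by (subst card_Un_disjoint) auto
  then obtain a b c where abc: "A \<union> C = {a, b, c}" "a \<noteq> b" "a \<noteq> c" "b \<noteq> c"
    by (auto simp: card_3_iff)
  have mem: "a < n" "b < n" "c < n" "v \<noteq> a" "v \<noteq> b" "v \<noteq> c"
    using abc C(1) A by auto
  have "lin_indep (B \<union> (\<lambda>a. {v, a}) ` (A \<union> C)) (cof_row x y)"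
  proof (rule lin_indep_star[OF B])
    show "finite (A \<union> C)" "v \<notin> A \<union> C" using \<open>finite A\<close> C A by auto
    fix d i assume d: "\<And>k. k < 3 \<Longrightarrow> (\<Sum>a\<in>A \<union> C. d a * Dvec x y v a k) = 0" and i: "i \<in> A \<union> C"
    have "d a = 0 \<and> d b = 0 \<and> d c = 0"
      by (rule conic_independent[of _ "x v - x a" _ "x v - x b" _ "x v - x c"
            "y v - y a" "y v - y b" "y v - y c"])
        (use d[of 0] d[of 1] d[of 2] abc mem A generic_config_noncollinear[OF gen] in
          \<open>auto simp: Dvec_def\<close>)
    then show "d i = 0" using i abc by auto
  qed
  then show ?thesis
    by (rule lin_indep_mono) (use B(1) finite_Kn_edges \<open>finite A\<close> C in \<open>auto intro: finite_subset\<close>)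
qed

text \<open>Moving \<open>v\<close> to the midpoint of \<open>a\<close> and \<open>b\<close> makes a combination of the rows of \<open>va\<close> and
  \<open>vb\<close> a multiple of the row of \<open>ab\<close>; independence at this special position implies independence
  at the generic one.\<close>
lemma lin_indep_four_star:
  assumes gen: "generic_config n x y"
    and B: "B \<subseteq> Kn_edges n" "\<And>e. e \<in> B \<Longrightarrow> v \<notin> e"
    and ab: "lin_indep (insert {a, b} B) (cof_row x y)" "{a, b} \<notin> B"
    and dist: "distinct [v, a, b, c, d]" "{v, a, b, c, d} \<subseteq> {..<n}"
  shows "lin_indep (B \<union> (\<lambda>a. {v, a}) ` {a, b, c, d}) (cof_row x y)"
proof (rule generic_config_lin_indep[OF gen])
  define x' where "x' = x(v := (x a + x b) / 2)"
  define y' where "y' = y(v := (y a + y b) / 2)"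
  let ?A = "{a, b, c, d}" and ?r = "cof_row x' y'"
  have fB: "finite B" using B(1) finite_Kn_edges finite_subset by blast
  show "B \<union> (\<lambda>a. {v, a}) ` ?A \<subseteq> Kn_edges n" using B(1) dist by auto
  \<comment> \<open>These edges avoid \<open>v\<close>, so moving \<open>v\<close> leaves their rows
    unchanged.\<close>
  have "lin_indep (insert {a, b} B) (cof_row x y) = lin_indep (insert {a, b} B) ?r"
    by (rule lin_indep_cong, rule cof_row_cong[of _ n])
      (use B dist in \<open>auto simp: x'_def y'_def\<close>)
  then have ind: "lin_indep (insert {a, b} B) ?r" using ab(1) by simp
  show "lin_indep (B \<union> (\<lambda>a. {v, a}) ` ?A) ?r"
  proof (rule lin_indepI)
    fix C e
    assume C: "\<And>k. (\<Sum>e\<in>B \<union> (\<lambda>a. {v, a}) ` ?A. C e * ?r e k) = 0"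
      and e: "e \<in> B \<union> (\<lambda>a. {v, a}) ` ?A"
    define D where "D a = C {v, a} * sgn_pair v a" for a
    have D: "(\<Sum>a\<in>?A. D a * Dvec x' y' v a k) = 0" if "k < 3" for k
    proof -
    have "finite ?A" "v \<notin> ?A" using dist by auto
    from star_sum_at_centre[OF B this that, where c = C and x = x' and y = y']
    show ?thesis unfolding C D_def by (rule sym)
  qed
    have Dk: "D a * Dvec x' y' v a k + D b * Dvec x' y' v b k + D c * Dvec x' y' v c k
        + D d * Dvec x' y' v d k = 0" if "k < 3" for k
      using D[OF that] dist by (simp add: add.assoc)
    have half: "x' v - x' a = (x b - x a) / 2" "x' v - x' b = (x a - x b) / 2"
        "y' v - y' a = (y b - y a) / 2" "y' v - y' b = (y a - y b) / 2"
      using dist by (auto simp: x'_def y'_def field_simps)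
    \<comment> \<open>The vectors from \<open>a\<close> and \<open>b\<close> to \<open>v\<close> are
      opposite halves of one segment; \<open>Dvec\<close> is quadratic, so the sign disappears and
      both give a quarter.\<close>
    have quarter: "Dvec x' y' v a k = Dvec x' y' a b k / 4" "Dvec x' y' v b k = Dvec x' y' a b k / 4" for k
      unfolding Dvec_def half using dist
      by (auto simp: x'_def y'_def field_simps power2_eq_square)
    \<comment> \<open>The directions of \<open>a\<close> and \<open>b\<close> coincide, which leaves
      three pairwise nonparallel directions, with coefficient \<open>D a + D b\<close> on the shared
      one.\<close>
    have "(D a + D b) = 0 \<and> D c = 0 \<and> D d = 0"
    proof (rule conic_independent[of _ "x' v - x' a" _ "x' v - x' c" _ "x' v - x' d"
            "y' v - y' a" "y' v - y' c" "y' v - y' d"])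
      have eq: "(D a + D b) * Dvec x' y' v a k + D c * Dvec x' y' v c k + D d * Dvec x' y' v d k = 0"
        if "k < 3" for k
        using Dk[OF that] unfolding quarter by (simp add: algebra_simps add_divide_distrib)
      show "(D a + D b) * (x' v - x' a)\<^sup>2 + D c * (x' v - x' c)\<^sup>2 + D d * (x' v - x' d)\<^sup>2 = 0"
        using eq[of 0] by (simp add: Dvec_def)
      show "(D a + D b) * ((x' v - x' a) * (y' v - y' a)) + D c * ((x' v - x' c) * (y' v - y' c))
          + D d * ((x' v - x' d) * (y' v - y' d)) = 0"
        using eq[of 1] by (simp add: Dvec_def)
      show "(D a + D b) * (y' v - y' a)\<^sup>2 + D c * (y' v - y' c)\<^sup>2 + D d * (y' v - y' d)\<^sup>2 = 0"
        using eq[of 2] by (simp add: Dvec_def)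
      have on_line: "cross (x' v - x' a) (y' v - y' a) (x' v - x' w) (y' v - y' w)
          = - cross (x a - x b) (y a - y b) (x a - x w) (y a - y w) / 2"
        if "w \<noteq> v" for w
        unfolding half using that dist
        by (simp add: x'_def y'_def cross_def field_simps)
      show "cross (x' v - x' a) (y' v - y' a) (x' v - x' c) (y' v - y' c) \<noteq> 0"
        using on_line[of c] generic_config_noncollinear[OF gen, of a b c] dist by auto
      show "cross (x' v - x' a) (y' v - y' a) (x' v - x' d) (y' v - y' d) \<noteq> 0"
        using on_line[of d] generic_config_noncollinear[OF gen, of a b d] dist by auto
      show "cross (x' v - x' c) (y' v - y' c) (x' v - x' d) (y' v - y' d) \<noteq> 0"
        using generic_config_midpoint_noncollinear[OF gen, of a b c d "x' v" "y' v"] dist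
        by (auto simp: x'_def y'_def)
    qed
    then have Dz: "D b = - D a" "D c = 0" "D d = 0" by auto
    \<comment> \<open>Since \<open>D b = - D a\<close>, the rows of \<open>va\<close> and
      \<open>vb\<close> cancel in the columns of \<open>v\<close>. At \<open>a\<close> and
      \<open>b\<close> they leave \<open>- D a / 4\<close> times the unsigned row of
      \<open>ab\<close>.\<close>
    let ?C = "\<lambda>e. if e = {a, b} then D a * sgn_pair a b / 4 * (- 1) else C e"
    have "(\<Sum>e\<in>insert {a, b} B. ?C e * ?r e k) = 0" for k
    proof -
      have inj: "inj_on (\<lambda>a. {v, a}) ?A" by (auto simp: inj_on_def doubleton_eq_iff)
      have row: "C {v, w} * ?r {v, w} k = D w * (if k div 3 = v then Dvec x' y' v w (k mod 3)
          else if k div 3 = w then - Dvec x' y' v w (k mod 3) else 0)" if "w \<in> ?A" for w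
        unfolding D_def using that dist by (subst cof_row_pair) auto
      have "(\<Sum>e\<in>B \<union> (\<lambda>a. {v, a}) ` ?A. C e * ?r e k)
          = (\<Sum>e\<in>B. C e * ?r e k) + (\<Sum>e\<in>(\<lambda>a. {v, a}) ` ?A. C e * ?r e k)"
        using fB B(2) by (intro sum.union_disjoint) auto
      also have "(\<Sum>e\<in>(\<lambda>a. {v, a}) ` ?A. C e * ?r e k)
          = C {v, a} * ?r {v, a} k + C {v, b} * ?r {v, b} k + C {v, c} * ?r {v, c} k + C {v, d} * ?r {v, d} k"
        unfolding sum.reindex[OF inj] using dist by (simp add: add.assoc)
      also have "\<dots> = ?C {a, b} * ?r {a, b} k"
        using dist sgn_pair_simps(2)[of a b] unfolding row[of a, simplified] row[of b, simplified]
          row[of c, simplified] row[of d, simplified] Dz quarter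
        by (subst cof_row_pair) (auto simp: algebra_simps)
      finally have "(\<Sum>e\<in>B. C e * ?r e k) + ?C {a, b} * ?r {a, b} k = 0" using C[of k] by simp
      moreover have "(\<Sum>e\<in>B. ?C e * ?r e k) = (\<Sum>e\<in>B. C e * ?r e k)"
        using ab(2) by (intro sum.cong) auto
      ultimately show ?thesis using fB ab(2) by simp
    qed
    from lin_indepD[OF ind this] have z: "?C e = 0" if "e \<in> insert {a, b} B" for e using that by blast
    have "D a = 0" using z[of "{a, b}"] by simp
    then have "C {v, w} = 0" if "w \<in> ?A" for w
      using that Dz unfolding D_def by auto
    moreover have "C e = 0" if "e \<in> B" using z[of e] that ab(2) by (auto split: if_splits)
    ultimately show "C e = 0" using e by auto
  qed
qed

section \<open>Rank and closure\<close>

text \<open>The trivial motions: the polynomial vector fields that annihilate the row of every edge.\<close>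
definition motion :: "(nat \<Rightarrow> real) \<Rightarrow> (nat \<Rightarrow> real) \<Rightarrow> nat \<Rightarrow> nat \<Rightarrow> nat \<Rightarrow> real" where
  "motion x y t v k =
     [[1, 0, 0], [0, 1, 0], [0, 0, 1], [y v, - x v, 0], [0, y v, - x v],
      [(y v)\<^sup>2, - 2 * x v * y v, (x v)\<^sup>2]] ! t ! k"

lemma sum_lessThan_3: "(\<Sum>k<3. h k) = h 0 + h 1 + h (2 :: nat)" for h :: "nat \<Rightarrow> real"
  by (simp add: eval_nat_numeral)

lemma sum_lessThan_6: "(\<Sum>k<6. h k) = h 0 + h 1 + h 2 + h 3 + h 4 + h (5 :: nat)" for h :: "nat \<Rightarrow> real"
  by (simp add: eval_nat_numeral)

lemma motion_orthogonal_edge: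
  assumes "t < 6"
  shows "(\<Sum>k<3. Dvec x y a b k * (motion x y t a k - motion x y t b k)) = 0"
proof -
  have "t = 0 \<or> t = 1 \<or> t = 2 \<or> t = 3 \<or> t = 4 \<or> t = 5" using assms by auto
  then show ?thesis
    by (elim disjE) (simp_all add: sum_lessThan_3 motion_def Dvec_def algebra_simps power2_eq_square)
qed

lemma quadratic_zero:
  fixes a b c :: real
  assumes "a + b * u + c * u^2 = 0" "a + b * v + c * v^2 = 0" "a + b * w + c * w^2 = 0"
    and "u \<noteq> v" "u \<noteq> w" "v \<noteq> w"
  shows "a = 0 \<and> b = 0 \<and> c = 0"
proof -
  have "(u - v) * (b + c * (u + v)) = 0" "(u - w) * (b + c * (u + w)) = 0"
    using assms(1-3) by algebra+
  then have e: "b + c * (u + v) = 0" "b + c * (u + w) = 0" using assms by auto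
  then have "c * (v - w) = 0" by algebra
  then have "c = 0" using assms by auto
  then show ?thesis using e assms(1) by auto
qed

definition cols :: "nat set \<Rightarrow> nat set" where
  "cols W = {col. col div 3 \<in> W}"

lemma cols_eq: "cols W = (\<lambda>(v, k). 3 * v + k) ` (W \<times> {..<3})"
proof
  show "cols W \<subseteq> (\<lambda>(v, k). 3 * v + k) ` (W \<times> {..<3})"
  proof
    fix c assume "c \<in> cols W"
    then have "(c div 3, c mod 3) \<in> W \<times> {..<3}" by (simp add: cols_def)
    moreover have "c = (\<lambda>(v, k). 3 * v + k) (c div 3, c mod 3)" by simp
    ultimately show "c \<in> (\<lambda>(v, k). 3 * v + k) ` (W \<times> {..<3})" by blast
  qed
qed (auto simp: cols_def)

lemma inj_on_cols: "inj_on (\<lambda>(v, k). 3 * v + k :: nat) (W \<times> {..<3})"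
  by (auto simp: inj_on_def) presburger+

lemma card_cols: "card (cols W) = 3 * card W"
  unfolding cols_eq card_image[OF inj_on_cols] by (simp add: card_cartesian_product)

lemma finite_cols: "finite W \<Longrightarrow> finite (cols W)"
  unfolding cols_eq by simp

lemma sum_cols: "(\<Sum>c\<in>cols W. h c) = (\<Sum>v\<in>W. \<Sum>k<3. h (3 * v + k))"
  unfolding cols_eq sum.reindex[OF inj_on_cols] sum.cartesian_product by (simp add: case_prod_beta)

lemma motion_orthogonal_cof_row:
  assumes "e \<in> Kn_edges n" "e \<subseteq> W" "finite W" "t < 6"
  shows "(\<Sum>c\<in>cols W. cof_row x y e c * motion x y t (c div 3) (c mod 3)) = 0"
proof -
  obtain a b where e: "e = {a, b}" "a \<noteq> b" using assms(1) by (elim Kn_edgesE)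
  have "(\<Sum>c\<in>cols W. cof_row x y e c * motion x y t (c div 3) (c mod 3))
      = (\<Sum>v\<in>W. \<Sum>k<3. cof_row x y e (3 * v + k) * motion x y t v k)"
    unfolding sum_cols by (intro sum.cong) auto
  also have "\<dots> = (\<Sum>v\<in>{a, b}. \<Sum>k<3. cof_row x y e (3 * v + k) * motion x y t v k)"
    using assms e by (intro sum.mono_neutral_right) (auto simp: cof_row_notin)
  also have "\<dots> = sgn_pair a b * (\<Sum>k<3. Dvec x y a b k * (motion x y t a k - motion x y t b k))"
  proof -
    have "cof_row x y e (3 * a + k) = sgn_pair a b * Dvec x y a b k"
        "cof_row x y e (3 * b + k) = - sgn_pair a b * Dvec x y a b k" if "k < 3" for k
      using that e(2) unfolding e(1) by (auto simp: cof_row_pair)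
    then have "(\<Sum>k<3. cof_row x y e (3 * a + k) * m k) = (\<Sum>k<3. sgn_pair a b * Dvec x y a b k * m k)"
        "(\<Sum>k<3. cof_row x y e (3 * b + k) * m k) = (\<Sum>k<3. - sgn_pair a b * Dvec x y a b k * m k)" for m
      by (auto intro!: sum.cong)
    then show ?thesis
      using e(2) by (simp add: sum_distrib_left sum_negf sum_subtractf[symmetric] algebra_simps)
  qed
  finally show ?thesis using motion_orthogonal_edge[OF assms(4)] by simp
qed

text \<open>Components 0 and 2 of a vanishing combination are quadratics in \<open>y v\<close> and
  \<open>x v\<close> with three distinct roots. They kill every coefficient but \<open>c 1\<close>,
  which component 1 then kills.\<close>

lemma motions_independent:
  assumes gen: "generic_config n x y" and W: "W \<subseteq> {..<n}" "3 \<le> card W"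
    and m: "\<And>v k. v \<in> W \<Longrightarrow> k < 3 \<Longrightarrow> (\<Sum>t<6. c t * motion x y t v k) = 0"
    and "t < 6"
  shows "c t = 0"
proof -
  obtain T where "T \<subseteq> W" "card T = 3" using obtain_subset_with_card_n[OF W(2)] by blast
  then obtain p q r where pqr: "p \<in> W" "q \<in> W" "r \<in> W" "p \<noteq> q" "p \<noteq> r" "q \<noteq> r"
    by (auto simp: card_3_iff)
  have dx: "x p \<noteq> x q" "x p \<noteq> x r" "x q \<noteq> x r" and dy: "y p \<noteq> y q" "y p \<noteq> y r" "y q \<noteq> y r"
    using pqr W(1) generic_config_distinct[OF gen] by (meson lessThan_iff subsetD)+
  have eq0: "c 0 + c 3 * y v + c 5 * (y v)^2 = 0"
    and eq2: "c 2 + (- c 4) * x v + c 5 * (x v)^2 = 0"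
    and eq1: "c 1 - c 3 * x v + c 4 * y v - 2 * c 5 * x v * y v = 0" if "v \<in> W" for v
    using m[OF that, of 0] m[OF that, of 1] m[OF that, of 2]
    by (simp_all add: sum_lessThan_6 motion_def algebra_simps)
  have "c 0 = 0 \<and> c 3 = 0 \<and> c 5 = 0"
    using quadratic_zero[OF eq0 eq0 eq0 dy] pqr by blast
  moreover have "c 2 = 0 \<and> - c 4 = 0 \<and> c 5 = 0"
    using quadratic_zero[OF eq2 eq2 eq2 dx] pqr by blast
  ultimately have "c 0 = 0" "c 1 = 0" "c 2 = 0" "c 3 = 0" "c 4 = 0" "c 5 = 0"
    using eq1[OF pqr(1)] by auto
  moreover have "t = 0 \<or> t = 1 \<or> t = 2 \<or> t = 3 \<or> t = 4 \<or> t = 5" using assms by auto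
  ultimately show ?thesis by auto
qed

text \<open>The six motions are orthogonal to all rows on \<open>W\<close>. Rows and motions
  together are therefore independent, inside a space of 3|W| columns.\<close>

lemma card_lin_indep_le:
  assumes gen: "generic_config n x y" and W: "W \<subseteq> {..<n}" "3 \<le> card W"
    and B: "B \<subseteq> Kn_edges n" "\<And>e. e \<in> B \<Longrightarrow> e \<subseteq> W" "lin_indep B (cof_row x y)"
  shows "card B + 6 \<le> 3 * card W"
proof -
  have fW: "finite W" and fB: "finite B"
    using W B finite_Kn_edges finite_subset by blast+
  define mrow where "mrow t col = (if col div 3 \<in> W then motion x y t (col div 3) (col mod 3) else 0)"
    for t col
  let ?R = "case_sum (cof_row x y) mrow"
  have "card (B <+> {..<6 :: nat}) \<le> card (cols W)"
  proof (rule lin_indep_card_le)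
    show "finite (B <+> {..<6 :: nat})" using fB by simp
    show "finite (cols W)" using fW by (rule finite_cols)
    show "?R i k = 0" if "i \<in> B <+> {..<6}" "k \<notin> cols W" for i k
    proof (cases i)
      case (Inl e)
      then have "e \<in> B" using that by auto
      then have "k div 3 \<notin> e" using that(2) B(2) by (auto simp: cols_def)
      then show ?thesis using Inl \<open>e \<in> B\<close> B(1) cof_row_notin by auto
    qed (use that in \<open>auto simp: cols_def mrow_def\<close>)
    show "lin_indep (B <+> {..<6 :: nat}) ?R"
    proof (rule lin_indepI)
      fix c i assume c: "\<And>k. (\<Sum>i\<in>B <+> {..<6 :: nat}. c i * ?R i k) = 0" and i: "i \<in> B <+> {..<6 :: nat}"
      define s where "s k = (\<Sum>t<6. c (Inr t) * mrow t k)" for k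
      define b where "b k = (\<Sum>e\<in>B. c (Inl e) * cof_row x y e k)" for k
      have bs: "b k + s k = 0" for k
        using c[of k] fB by (simp add: sum.Plus s_def b_def)
      have orth: "(\<Sum>k\<in>cols W. cof_row x y e k * mrow t k) = 0" if "e \<in> B" "t < 6" for e t
      proof -
        have "(\<Sum>k\<in>cols W. cof_row x y e k * mrow t k)
            = (\<Sum>k\<in>cols W. cof_row x y e k * motion x y t (k div 3) (k mod 3))"
          by (rule sum.cong) (auto simp: mrow_def cols_def)
        then show ?thesis using motion_orthogonal_cof_row[of e n W t x y] that B fW by auto
      qed
      \<comment> \<open>The edge part \<open>b\<close> and the motion part \<open>s\<close> are
        orthogonal and add up to zero, so the squares of \<open>s\<close> sum to zero.\<close>
      have "(\<Sum>k\<in>cols W. b k * s k)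
          = (\<Sum>k\<in>cols W. \<Sum>e\<in>B. \<Sum>t<6. c (Inl e) * c (Inr t) * (cof_row x y e k * mrow t k))"
        unfolding b_def s_def sum_product by (simp add: mult_ac)
      also have "\<dots> = (\<Sum>e\<in>B. \<Sum>t<6. \<Sum>k\<in>cols W. c (Inl e) * c (Inr t) * (cof_row x y e k * mrow t k))"
        by (subst sum.swap, rule sum.cong[OF refl], rule sum.swap)
      also have "\<dots> = 0" using orth by (simp add: sum_distrib_left[symmetric])
      finally have "(\<Sum>k\<in>cols W. b k * s k) = 0" .
      moreover have "b k * s k = - (s k)\<^sup>2" for k
        using bs[of k] by algebra
      ultimately have "(\<Sum>k\<in>cols W. (s k)\<^sup>2) = 0" by (simp add: sum_negf)
      then have s0: "s k = 0" if "k \<in> cols W" for k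
        using that finite_cols[OF fW] by (simp add: sum_nonneg_eq_0_iff)
      have "(\<Sum>t<6. c (Inr t) * motion x y t v k) = 0" if "v \<in> W" "k < 3" for v k
        using s0[of "3 * v + k"] that by (simp add: s_def mrow_def cols_def)
      then have ct: "c (Inr t) = 0" if "t < 6" for t
        using motions_independent[OF gen W, of "\<lambda>t. c (Inr t)"] that by blast
      then have "b k = 0" for k using bs[of k] by (simp add: s_def)
      then have "c (Inl e) = 0" if "e \<in> B" for e
        using lin_indepD[OF B(3), of "\<lambda>e. c (Inl e)"] that by (simp add: b_def)
      then show "c i = 0" using ct i by auto
    qed
  qed
  then show ?thesis using fB by (simp add: card_Plus card_cols)
qed

section \<open>Closed edge sets\<close>

definition cof_closure :: "nat \<Rightarrow> (nat \<Rightarrow> real) \<Rightarrow> (nat \<Rightarrow> real) \<Rightarrow> nat set set \<Rightarrow> nat set set" where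
  "cof_closure n x y X = {e \<in> Kn_edges n. in_cof_closure x y X e}"

lemma cof_closure_superset:
  assumes "X \<subseteq> Kn_edges n" shows "X \<subseteq> cof_closure n x y X"
proof
  fix e assume e: "e \<in> X"
  have "finite X" using assms finite_Kn_edges finite_subset by blast
  then have "cof_row x y e = (\<lambda>col. \<Sum>f\<in>X. (if f = e then 1 else 0) * cof_row x y f col)"
    using e by (simp add: if_distrib[of "\<lambda>u. u * _"] cong: if_cong)
  then show "e \<in> cof_closure n x y X"
    using e assms unfolding cof_closure_def in_cof_closure_def
    by (intro CollectI conjI exI[of _ "\<lambda>f. if f = e then 1 else 0"]) auto
qed

text \<open>A relation with a nonzero coefficient at \<open>e\<close> could be solved for the row of
  \<open>e\<close>; expanding the rows of \<open>B\<close> over \<open>X\<close> would put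
  \<open>e\<close> into the closure.\<close>

lemma lin_indep_insert_cof_closure:
  assumes B: "B \<subseteq> cof_closure n x y X" "lin_indep B (cof_row x y)"
    and e: "e \<in> Kn_edges n" "e \<notin> cof_closure n x y X"
  shows "lin_indep (insert e B) (cof_row x y)"
proof (rule lin_indepI)
  fix c f assume c: "\<And>k. (\<Sum>f\<in>insert e B. c f * cof_row x y f k) = 0" and f: "f \<in> insert e B"
  have "finite B" using B(1) finite_Kn_edges[of n] by (auto simp: cof_closure_def intro: finite_subset)
  then have c': "c e * cof_row x y e k + (\<Sum>f\<in>B. c f * cof_row x y f k) = 0" for k
    using c[of k] e(2) B(1) by (subst (asm) sum.insert) auto
  have "\<forall>f\<in>B. \<exists>d. cof_row x y f = (\<lambda>k. \<Sum>g\<in>X. d g * cof_row x y g k)"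
    using B(1) by (auto simp: cof_closure_def in_cof_closure_def)
  then obtain d where d: "\<And>f. f \<in> B \<Longrightarrow> cof_row x y f = (\<lambda>k. \<Sum>g\<in>X. d f g * cof_row x y g k)"
    by metis
  have ce: "c e = 0"
  proof (rule ccontr)
    assume "c e \<noteq> 0"
    have "cof_row x y e k = (\<Sum>g\<in>X. (- (\<Sum>f\<in>B. c f * d f g) / c e) * cof_row x y g k)" for k
    proof -
      have "(\<Sum>f\<in>B. c f * cof_row x y f k) = (\<Sum>f\<in>B. c f * (\<Sum>g\<in>X. d f g * cof_row x y g k))"
        using d by (metis (mono_tags, lifting) sum.cong)
      also have "\<dots> = (\<Sum>f\<in>B. \<Sum>g\<in>X. c f * d f g * cof_row x y g k)"
        by (simp add: sum_distrib_left mult.assoc)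
      also have "\<dots> = (\<Sum>g\<in>X. (\<Sum>f\<in>B. c f * d f g) * cof_row x y g k)"
        by (subst sum.swap) (simp add: sum_distrib_right)
      finally have "cof_row x y e k = - (\<Sum>g\<in>X. (\<Sum>f\<in>B. c f * d f g) * cof_row x y g k) / c e"
        using c'[of k] \<open>c e \<noteq> 0\<close> by (simp add: field_simps)
      then show ?thesis
        by (simp add: sum_divide_distrib[of _ X] sum_negf)
    qed
    then have "cof_row x y e = (\<lambda>k. \<Sum>g\<in>X. (- (\<Sum>f\<in>B. c f * d f g) / c e) * cof_row x y g k)"
      by (rule ext)
    then have "in_cof_closure x y X e" unfolding in_cof_closure_def
      by (intro exI[of _ "\<lambda>g. - (\<Sum>f\<in>B. c f * d f g) / c e"])
    then show False using e unfolding cof_closure_def by blast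
  qed
  then show "c f = 0" using lin_indepD[OF B(2), of c f] c' f by auto
qed

section \<open>Rank along an insertion order\<close>

definition clique :: "'a set set \<Rightarrow> 'a set \<Rightarrow> bool" where
  "clique H A \<longleftrightarrow> (\<forall>a\<in>A. \<forall>b\<in>A. a \<noteq> b \<longrightarrow> {a, b} \<in> H)"

definition nbrs :: "'a set set \<Rightarrow> 'a \<Rightarrow> 'a set" where
  "nbrs H v = {u. {v, u} \<in> H}"

text \<open>The rank gained when a vertex joined to \<open>A\<close> is added.\<close>
definition gain :: "'a set set \<Rightarrow> 'a set \<Rightarrow> nat" where
  "gain H A = (if 4 \<le> card A \<and> \<not> clique H A then 4 else min (card A) 3)"

text \<open>Lists grow at the head, so the entries after \<open>v\<close> are the vertices inserted before \<open>v\<close>.\<close>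
fun later :: "'a list \<Rightarrow> 'a \<Rightarrow> 'a set" where
  "later [] v = {}"
| "later (x # xs) v = (if x = v then set xs else later xs v)"

lemma later_subset: "later xs v \<subseteq> set xs"
  by (induction xs) auto

lemma sum_later_Cons:
  assumes "distinct (x # xs)"
  shows "(\<Sum>v\<in>set (x # xs). \<phi> v (later (x # xs) v)) = \<phi> x (set xs) + (\<Sum>v\<in>set xs. \<phi> v (later xs v))"
proof -
  have "(\<Sum>v\<in>set xs. \<phi> v (later (x # xs) v)) = (\<Sum>v\<in>set xs. \<phi> v (later xs v))"
    using assms by (intro sum.cong) auto
  then show ?thesis using assms by simp
qed

lemma card_star_union:
  assumes "finite B" "\<And>e. e \<in> B \<Longrightarrow> v \<notin> e" "finite A"
  shows "card (B \<union> (\<lambda>a. {v, a}) ` A) = card B + card A"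
proof -
  have "inj_on (\<lambda>a. {v, a}) A" by (auto simp: inj_on_def doubleton_eq_iff)
  moreover have "B \<inter> (\<lambda>a. {v, a}) ` A = {}" using assms(2) by auto
  ultimately show ?thesis using assms by (simp add: card_Un_disjoint card_image)
qed

text \<open>Vertices are added one at a time, each with a star of \<open>gain\<close> many edges. In
  the gain 4 case the non-edge \<open>ab\<close> lies outside the closed set \<open>H\<close>, so
  adding it to \<open>B\<close> keeps independence, as the 1-extension requires.\<close>

lemma lin_indep_ordering:
  assumes gen: "generic_config n x y" and "4 \<le> n" and H: "H = cof_closure n x y X"
    and xs: "distinct xs" "set xs \<subseteq> {..<n}"
  shows "\<exists>B\<subseteq>H. (\<forall>e\<in>B. e \<subseteq> set xs) \<and> lin_indep B (cof_row x y) \<and>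
    card B = (\<Sum>v\<in>set xs. gain H (nbrs H v \<inter> later xs v))"
  using xs
proof (induction xs)
  case Nil
  then show ?case by (intro exI[of _ "{}"]) (simp add: lin_indep_def)
next
  case (Cons v xs)
  then obtain B where B: "B \<subseteq> H" "\<forall>e\<in>B. e \<subseteq> set xs" "lin_indep B (cof_row x y)"
      "card B = (\<Sum>v\<in>set xs. gain H (nbrs H v \<inter> later xs v))"
    by auto
  have BK: "B \<subseteq> Kn_edges n" using B(1) by (auto simp: H cof_closure_def)
  have vB: "v \<notin> e" if "e \<in> B" for e using that B(2) Cons.prems by auto
  let ?N = "nbrs H v \<inter> set xs"
  have N: "?N \<subseteq> {..<n}" "v \<notin> ?N" "finite ?N" using Cons.prems by auto
  have "\<exists>A\<subseteq>?N. card A = gain H ?N \<and> lin_indep (B \<union> (\<lambda>a. {v, a}) ` A) (cof_row x y)"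
  proof (cases "4 \<le> card ?N \<and> \<not> clique H ?N")
    case True
    then obtain a b where ab: "a \<in> ?N" "b \<in> ?N" "a \<noteq> b" "{a, b} \<notin> H"
      by (auto simp: clique_def)
    have "card (?N - {a, b}) = card ?N - 2" using ab by (subst card_Diff_subset) auto
    then have "2 \<le> card (?N - {a, b})" using True by linarith
    then obtain T where "T \<subseteq> ?N - {a, b}" "card T = 2" by (metis obtain_subset_with_card_n)
    then obtain c d where cd: "c \<in> ?N" "d \<in> ?N" "distinct [v, a, b, c, d]"
      using ab N(2) by (auto simp: card_2_iff)
    have "lin_indep (B \<union> (\<lambda>a. {v, a}) ` {a, b, c, d}) (cof_row x y)"
    proof (rule lin_indep_four_star[OF gen BK vB])
      show "lin_indep (insert {a, b} B) (cof_row x y)"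
        by (rule lin_indep_insert_cof_closure[of _ n x y X]) (use B ab N in \<open>auto simp: H\<close>)
      show "{a, b} \<notin> B" "distinct [v, a, b, c, d]" "{v, a, b, c, d} \<subseteq> {..<n}"
        using ab cd B(1) Cons.prems by auto
    qed auto
    moreover have "card {a, b, c, d} = gain H ?N" "{a, b, c, d} \<subseteq> ?N"
      using True ab cd by (simp_all add: gain_def)
    ultimately show ?thesis by blast
  next
    case False
    obtain A where A: "A \<subseteq> ?N" "card A = min (card ?N) 3"
      by (rule obtain_subset_with_card_n[of "min (card ?N) 3" ?N]) simp_all
    have "lin_indep (B \<union> (\<lambda>a. {v, a}) ` A) (cof_row x y)"
    proof (rule lin_indep_three_star[OF gen \<open>4 \<le> n\<close> BK vB B(3)])
      show "A \<subseteq> {..<n}" "v \<notin> A" using A(1) N(1,2) by blast+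
      show "card A \<le> 3" "v < n" using A(2) Cons.prems by auto
    qed auto
    moreover have "card A = gain H ?N" using A(2) False by (simp add: gain_def)
    ultimately show ?thesis using A(1) by blast
  qed
  then obtain A where A: "A \<subseteq> ?N" "card A = gain H ?N"
      "lin_indep (B \<union> (\<lambda>a. {v, a}) ` A) (cof_row x y)" by blast
  have "finite A" "finite B"
    using A(1) N(3) BK finite_Kn_edges by (auto intro: finite_subset)
  then have "card (B \<union> (\<lambda>a. {v, a}) ` A) = card B + gain H ?N"
    using vB A(2) by (simp add: card_star_union)
  moreover have "(\<Sum>u\<in>set (v # xs). gain H (nbrs H u \<inter> later (v # xs) u)) = gain H ?N + card B"
    using sum_later_Cons[OF Cons.prems(1), of "\<lambda>u A. gain H (nbrs H u \<inter> A)"] B(4) by simp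
  ultimately have "card (B \<union> (\<lambda>a. {v, a}) ` A)
      = (\<Sum>u\<in>set (v # xs). gain H (nbrs H u \<inter> later (v # xs) u))" by linarith
  moreover have "B \<union> (\<lambda>a. {v, a}) ` A \<subseteq> H" "\<forall>e\<in>B \<union> (\<lambda>a. {v, a}) ` A. e \<subseteq> set (v # xs)"
    using A(1) B(1,2) by (auto simp: nbrs_def)
  ultimately show ?case using A(3) by blast
qed

text \<open>On five vertices the rank is at most \<open>9\<close>, and \<open>K\<^sub>5\<close> minus an edge already attains it.\<close>
lemma cof_closure_K5:
  assumes gen: "generic_config n x y" and H: "H = cof_closure n x y X"
    and dist: "distinct [a, b, p, q, r]" "a < n" "b < n"
    and edges: "{p, q} \<in> H" "{p, r} \<in> H" "{q, r} \<in> H" "{p, a} \<in> H" "{q, a} \<in> H" "{r, a} \<in> H"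
      "{p, b} \<in> H" "{q, b} \<in> H" "{r, b} \<in> H"
  shows "{a, b} \<in> H"
proof (rule ccontr)
  assume ab: "{a, b} \<notin> H"
  \<comment> \<open>Inserted in the order \<open>p\<close>, \<open>q\<close>, \<open>r\<close>,
    \<open>a\<close>, \<open>b\<close>, the vertices gain 0 + 1 + 2 + 3 + 3 = 9.\<close>
  let ?xs = "[b, a, r, q, p]"
  have less: "p < n" "q < n" "r < n"
    using edges by (auto simp: H cof_closure_def)
  have xs: "distinct ?xs" "set ?xs \<subseteq> {..<n}" using dist less by auto
  have "card (set ?xs) = 5" using distinct_card[OF xs(1)] by simp
  moreover have "card (set ?xs) \<le> n" using card_mono[OF _ xs(2)] by simp
  ultimately have n: "4 \<le> n" by simp
  obtain B where B: "B \<subseteq> H" "\<forall>e\<in>B. e \<subseteq> set ?xs" "lin_indep B (cof_row x y)"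
      "card B = (\<Sum>v\<in>set ?xs. gain H (nbrs H v \<inter> later ?xs v))"
    using lin_indep_ordering[OF gen n H xs] by blast
  have N: "nbrs H b \<inter> {a, r, q, p} = {r, q, p}" "nbrs H a \<inter> {r, q, p} = {r, q, p}"
      "nbrs H r \<inter> {q, p} = {q, p}" "nbrs H q \<inter> {p} = {p}"
    using edges ab by (auto simp: nbrs_def insert_commute)
  have "card B = 9" unfolding B(4) using xs(1) by (simp add: N gain_def)
  have BK: "B \<subseteq> Kn_edges n" using B(1) by (auto simp: H cof_closure_def)
  have "card (insert {a, b} B) + 6 \<le> 3 * card (set ?xs)"
  proof (rule card_lin_indep_le[OF gen xs(2)])
    show "lin_indep (insert {a, b} B) (cof_row x y)"
      by (rule lin_indep_insert_cof_closure[of _ n x y X]) (use B ab dist in \<open>auto simp: H\<close>)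
  qed (use \<open>card (set ?xs) = 5\<close> BK B(2) dist in auto)
  moreover have "card (insert {a, b} B) = 10"
    using \<open>card B = 9\<close> ab B(1) BK finite_Kn_edges
    by (subst card_insert_disjoint) (auto intro: finite_subset)
  ultimately show False using \<open>card (set ?xs) = 5\<close> by simp
qed

section \<open>Clique counts and random orderings\<close>

text \<open>The condition that \<open>N\<close> induces no \<open>K_4\<close> minus an edge.\<close>

definition diamond_free :: "'a set set \<Rightarrow> 'a set \<Rightarrow> bool" where
  "diamond_free H N \<longleftrightarrow> (\<forall>a\<in>N. \<forall>b\<in>N. \<forall>p\<in>N. \<forall>q\<in>N. distinct [a, b, p, q] \<longrightarrow>
     {p, q} \<in> H \<longrightarrow> {p, a} \<in> H \<longrightarrow> {q, a} \<in> H \<longrightarrow> {p, b} \<in> H \<longrightarrow> {q, b} \<in> H \<longrightarrow> {a, b} \<in> H)"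

lemma diamond_freeD:
  assumes "diamond_free H N" "{a, b, p, q} \<subseteq> N" "distinct [a, b, p, q]"
    and "{p, q} \<in> H" "{p, a} \<in> H" "{q, a} \<in> H" "{p, b} \<in> H" "{q, b} \<in> H"
  shows "{a, b} \<in> H"
  using assms unfolding diamond_free_def by blast

lemma card_offdiagonal:
  assumes "finite A"
  shows "card {(p, q). p \<in> A \<and> q \<in> A \<and> p \<noteq> q} = card A * (card A - 1)"
proof -
  have "{(p, q). p \<in> A \<and> q \<in> A \<and> p \<noteq> q} = (SIGMA p:A. A - {p})" by auto
  then show ?thesis using assms by (simp add: card_SigmaI)
qed

text \<open>Here \<open>N\<close> stands for the number of \<open>k\<close>-cliques on
  \<open>D\<close> vertices, and the hypothesis is the double count over ordered pairs. Absorption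
  identities bring both sides over the common factor \<open>(D - 3) choose (k - 2)\<close>.\<close>

lemma choose_double_count_bound:
  assumes "4 \<le> k"
    and "k * (k - 1) * N \<le> D * (D - 1) * ((D - 4) choose (k - 2))"
  shows "N \<le> (D - 1) choose k"
proof (cases "k + 1 \<le> D")
  case False
  then have "D - 4 < k - 2" using assms(1) by linarith
  then have "k * (k - 1) * N = 0" using assms(2) by (simp add: binomial_eq_0)
  then show ?thesis using assms(1) by simp
next
  case True
  then obtain d where d: "D = k + 1 + d" using le_Suc_ex by blast
  obtain j where j: "k = j + 4" using assms(1) by (metis le_add_diff_inverse2)
  let ?b = "(D - 3) choose (k - 2)" and ?c = "(D - 4) choose (k - 2)"
  have D3: "D - 3 = Suc (Suc (j + d))" "D - 4 = Suc (j + d)" "D - 1 = j + d + 4" "k - 2 = Suc (Suc j)"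
    using d j by auto
  have "(D - 3 - (k - 2)) * ?b = (D - 3) * ((D - 3 - 1) choose (k - 2))"
    by (rule binomial_absorb_comp)
  then have 1: "d * ?b = (D - 3) * ?c" using d j by simp
  have 2: "k * (k - 1) * ((D - 1) choose k) = (D - 1) * (D - 2) * ?b"
  proof -
    have "k * ((D - 1) choose k) = (D - 1) * ((D - 2) choose (k - 1))"
      using times_binomial_minus1_eq[of k "D - 1"] assms(1)
      unfolding diff_diff_left one_add_one by simp
    moreover have "(k - 1) * ((D - 2) choose (k - 1)) = (D - 2) * ?b"
      using times_binomial_minus1_eq[of "k - 1" "D - 2"] assms(1)
      unfolding diff_diff_left by (simp add: numeral_eq_Suc)
    ultimately show ?thesis by (metis mult.assoc mult.commute)
  qed
  have "(D - 3) * (k * (k - 1) * N) \<le> D * (D - 1) * ((D - 3) * ?c)"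
    using mult_le_mono2[OF assms(2), of "D - 3"] by (simp add: mult_ac)
  also have "\<dots> = (D - 1) * (D * d * ?b)" unfolding 1[symmetric] by (simp add: mult_ac)
  also have "\<dots> \<le> (D - 1) * ((D - 2) * (D - 3) * ?b)"
  proof -
    \<comment> \<open>The difference of the two sides is \<open>D * j + 6\<close>; this is where
      \<open>k \<ge> 4\<close> enters.\<close>
    have "D * d \<le> (D - 2) * (D - 3)" unfolding d j by (simp add: algebra_simps)
    then show ?thesis by (intro mult_le_mono2 mult_le_mono1)
  qed
  also have "\<dots> = (D - 3) * (k * (k - 1) * ((D - 1) choose k))" unfolding 2 by (simp add: mult_ac)
  finally have "(D - 3) * (k * (k - 1)) * N \<le> (D - 3) * (k * (k - 1)) * ((D - 1) choose k)"
    by (simp add: mult_ac)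
  moreover have "0 < (D - 3) * (k * (k - 1))" using d j by simp
  ultimately show ?thesis by simp
qed

text \<open>In a diamond-free graph every edge lies in a unique maximal clique. If some maximal clique
  misses one vertex, no other clique has four vertices; otherwise count pairs of an edge and
  a \<open>k\<close>-clique containing it.\<close>
lemma card_cliques_le:
  assumes fin: "finite N" and df: "diamond_free H N" and nc: "\<not> clique H N" and k: "4 \<le> k"
  shows "card {A. A \<subseteq> N \<and> card A = k \<and> clique H A} \<le> (card N - 1) choose k"
proof (cases "\<exists>y\<in>N. clique H (N - {y})")
  case True
  then obtain y where y: "y \<in> N" "clique H (N - {y})" by blast
  \<comment> \<open>Let \<open>a\<close> be a non-neighbour of \<open>y\<close>. A
    \<open>k\<close>-clique through \<open>y\<close> has two vertices \<open>p\<close>,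
    \<open>q\<close> other than \<open>y\<close> and \<open>a\<close>, and diamond-freeness on
    \<open>y\<close>, \<open>a\<close>, \<open>p\<close>, \<open>q\<close> would force the edge
    \<open>ya\<close>.\<close>
  have "y \<notin> A" if A: "A \<subseteq> N" "card A = k" "clique H A" for A
  proof
    assume "y \<in> A"
    obtain a where a: "a \<in> N" "a \<noteq> y" "{y, a} \<notin> H"
      using nc y unfolding clique_def by (metis Diff_iff insert_commute singletonD)
    have "3 \<le> card (A - {y})" using A(2) \<open>y \<in> A\<close> k by simp
    then obtain T where T: "T \<subseteq> A - {y}" "card T = 3" by (rule obtain_subset_with_card_n)
    then have "2 \<le> card (T - {a})" by (cases "a \<in> T") auto
    then obtain U where "U \<subseteq> T - {a}" "card U = 2" by (rule obtain_subset_with_card_n)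
    then obtain p q where pq: "p \<in> A" "q \<in> A" "p \<noteq> q" "p \<noteq> y" "q \<noteq> y" "p \<noteq> a" "q \<noteq> a"
      using T(1) by (auto simp: card_2_iff)
    have "{p, q} \<in> H" "{p, y} \<in> H" "{q, y} \<in> H"
      using A(3) pq \<open>y \<in> A\<close> unfolding clique_def by blast+
    moreover have "{p, a} \<in> H" "{q, a} \<in> H"
      using y(2) pq a A(1) unfolding clique_def by blast+
    ultimately have "{y, a} \<in> H"
      by (intro diamond_freeD[OF df, of y a p q]) (use pq a y A(1) in auto)
    then show False using a(3) by blast
  qed
  then have "{A. A \<subseteq> N \<and> card A = k \<and> clique H A} \<subseteq> {A. A \<subseteq> N - {y} \<and> card A = k}" by blast
  then have "card {A. A \<subseteq> N \<and> card A = k \<and> clique H A} \<le> card {A. A \<subseteq> N - {y} \<and> card A = k}"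
    using fin by (intro card_mono) auto
  then show ?thesis using fin y(1) by (simp add: n_subsets)
next
  case False
  let ?K = "{A. A \<subseteq> N \<and> card A = k \<and> clique H A}"
  let ?P = "{(p, q). p \<in> N \<and> q \<in> N \<and> p \<noteq> q}"
  have finK: "finite ?K" using fin by simp
  have finP: "finite ?P" by (rule finite_subset[of _ "N \<times> N"]) (use fin in auto)
  have through_edge: "card {A \<in> ?K. p \<in> A \<and> q \<in> A} \<le> (card N - 4) choose (k - 2)"
    if pq: "p \<in> N" "q \<in> N" "p \<noteq> q" for p q
  proof (cases "{p, q} \<in> H")
    case False
    then have "{A \<in> ?K. p \<in> A \<and> q \<in> A} = {}" using pq(3) unfolding clique_def by blast
    then show ?thesis by (metis card.empty le0)
  next
    case True
    \<comment> \<open>\<open>L\<close> together with \<open>p\<close> and \<open>q\<close> is the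
      maximal clique through the edge \<open>pq\<close>, so a clique containing this edge is
      determined by a subset of \<open>L\<close>.\<close>
    define L where "L = {r \<in> N - {p, q}. {p, r} \<in> H \<and> {q, r} \<in> H}"
    let ?M = "insert p (insert q L)"
    have LN: "L \<subseteq> N" "p \<notin> L" "q \<notin> L" "finite L" using fin by (auto simp: L_def)
    have "{a, b} \<in> H" if "a \<in> L" "b \<in> L" "a \<noteq> b" for a b
      by (rule diamond_freeD[OF df, of a b p q]) (use that True pq in \<open>auto simp: L_def\<close>)
    moreover have "{p, r} \<in> H" "{r, p} \<in> H" "{q, r} \<in> H" "{r, q} \<in> H" if "r \<in> L" for r
      using that unfolding L_def by (simp_all add: insert_commute)
    moreover have "{q, p} \<in> H" using True by (simp add: insert_commute)
    ultimately have M: "clique H ?M"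
      using True unfolding clique_def by blast
    \<comment> \<open>Neither \<open>N\<close> nor \<open>N\<close> minus one vertex is a clique, so
      the maximal clique misses at least two vertices and \<open>L\<close> has at most |N| -
      4.\<close>
    have "card (N - ?M) \<noteq> 0"
    proof
      assume "card (N - ?M) = 0"
      then have "N \<subseteq> ?M" using fin by simp
      then have "clique H N" using M unfolding clique_def by blast
      then show False using nc by simp
    qed
    moreover have "card (N - ?M) \<noteq> 1"
    proof
      assume "card (N - ?M) = 1"
      then obtain y where "N - ?M = {y}" by (auto simp: card_1_singleton_iff)
      then have "y \<in> N" "N - {y} \<subseteq> ?M" by blast+
      then have "clique H (N - {y})" using M unfolding clique_def by blast
      then show False using False \<open>y \<in> N\<close> \<open>\<not> (\<exists>y\<in>N. clique H (N - {y}))\<close> by blast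
    qed
    moreover have "card (N - ?M) = card N - (card L + 2)"
      using LN pq by (subst card_Diff_subset) auto
    ultimately have L4: "card L \<le> card N - 4" by linarith
    have "card {A \<in> ?K. p \<in> A \<and> q \<in> A} \<le> card {B. B \<subseteq> L \<and> card B = k - 2}"
    proof (rule card_inj_on_le)
      show "inj_on (\<lambda>A. A - {p, q}) {A \<in> ?K. p \<in> A \<and> q \<in> A}" by (auto simp: inj_on_def)
      show "(\<lambda>A. A - {p, q}) ` {A \<in> ?K. p \<in> A \<and> q \<in> A} \<subseteq> {B. B \<subseteq> L \<and> card B = k - 2}"
      proof (clarify, intro conjI)
        fix A assume A: "A \<subseteq> N" "k = card A" "clique H A" "p \<in> A" "q \<in> A"
        show "A - {p, q} \<subseteq> L"
        proof
          fix r assume r: "r \<in> A - {p, q}"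
          then have "{p, r} \<in> H" "{q, r} \<in> H" using A(3-5) by (auto simp: clique_def)
          then show "r \<in> L" using r A(1) by (auto simp: L_def)
        qed
        show "card (A - {p, q}) = card A - 2" using A pq by (subst card_Diff_subset) auto
      qed
      show "finite {B. B \<subseteq> L \<and> card B = k - 2}" using LN by simp
    qed
    also have "\<dots> = card L choose (k - 2)" using LN by (simp add: n_subsets)
    also have "\<dots> \<le> (card N - 4) choose (k - 2)" by (rule binomial_right_mono[OF L4])
    finally show ?thesis .
  qed
  \<comment> \<open>Incidences between \<open>k\<close>-cliques and the ordered pairs inside them
    are counted in two ways.\<close>
  have "k * (k - 1) * card ?K = (\<Sum>A\<in>?K. card {e \<in> ?P. fst e \<in> A \<and> snd e \<in> A})"
  proof -
    have "card {e \<in> ?P. fst e \<in> A \<and> snd e \<in> A} = k * (k - 1)" if "A \<in> ?K" for A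
    proof -
      have "finite A" using that fin finite_subset by blast
      moreover have "{e \<in> ?P. fst e \<in> A \<and> snd e \<in> A} = {(p, q). p \<in> A \<and> q \<in> A \<and> p \<noteq> q}"
        using that by auto
      ultimately show ?thesis using that card_offdiagonal[of A] by simp
    qed
    then show ?thesis by simp
  qed
  also have "\<dots> = (\<Sum>e\<in>?P. card {A \<in> ?K. fst e \<in> A \<and> snd e \<in> A})"
    by (rule sum_multicount_gen[OF finK finP]) simp
  also have "\<dots> \<le> card ?P * ((card N - 4) choose (k - 2))"
    using sum_bounded_above[of ?P "\<lambda>e. card {A \<in> ?K. fst e \<in> A \<and> snd e \<in> A}" "(card N - 4) choose (k - 2)"]
      through_edge by fastforce
  finally show ?thesis
    using k unfolding card_offdiagonal[OF fin] by (intro choose_double_count_bound)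
qed

section \<open>Symmetry of uniformly random insertion orders\<close>

definition orderings :: "'a set \<Rightarrow> 'a list set" where
  "orderings W = {xs. distinct xs \<and> set xs = W}"

lemma finite_orderings: "finite W \<Longrightarrow> finite (orderings W)"
  by (rule finite_subset[of _ "{xs. set xs \<subseteq> W \<and> length xs = card W}"])
    (auto simp: orderings_def distinct_card finite_lists_length_eq)

lemma orderings_nonempty: "finite W \<Longrightarrow> orderings W \<noteq> {}"
  using finite_distinct_list[of W] by (auto simp: orderings_def)

text \<open>The number of elements of \<open>M\<close> inserted before \<open>v\<close> is the
  position of \<open>v\<close> within \<open>M\<close>, counted from 0.\<close>

lemma bij_betw_card_later:
  assumes "distinct xs"
  shows "bij_betw (\<lambda>v. card (later xs v \<inter> M)) (set xs \<inter> M) {..<card (set xs \<inter> M)}"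
  using assms
proof (induction xs)
  case Nil
  then show ?case by (simp add: bij_betw_def)
next
  case (Cons x xs)
  have same: "card (later (x # xs) v \<inter> M) = card (later xs v \<inter> M)" if "v \<in> set xs \<inter> M" for v
    using that Cons.prems by auto
  have IH: "bij_betw (\<lambda>v. card (later (x # xs) v \<inter> M)) (set xs \<inter> M) {..<card (set xs \<inter> M)}"
    using Cons by (subst bij_betw_cong[OF same]) auto
  show ?case
  proof (cases "x \<in> M")
    case True
    have "bij_betw (\<lambda>v. card (later (x # xs) v \<inter> M)) (set xs \<inter> M \<union> {x})
        ({..<card (set xs \<inter> M)} \<union> {card (set xs \<inter> M)})"
      by (rule bij_betw_combine[OF IH]) (auto simp: bij_betw_def)
    moreover have "set (x # xs) \<inter> M = set xs \<inter> M \<union> {x}" using True by auto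
    moreover have "card (set (x # xs) \<inter> M) = Suc (card (set xs \<inter> M))" using True Cons.prems by simp
    ultimately show ?thesis by (simp add: lessThan_Suc)
  next
    case False
    then show ?thesis using IH by simp
  qed
qed

lemma later_map:
  assumes "inj_on \<sigma> (insert v (set xs))"
  shows "later (map \<sigma> xs) (\<sigma> v) = \<sigma> ` later xs v"
  using assms
proof (induction xs)
  case (Cons x xs)
  have "\<sigma> x = \<sigma> v \<longleftrightarrow> x = v" using Cons.prems by (auto simp: inj_on_def)
  moreover have "inj_on \<sigma> (insert v (set xs))" using Cons.prems by (auto simp: inj_on_def)
  ultimately show ?case using Cons.IH by simp
qed simp

lemma later_irrefl: "distinct xs \<Longrightarrow> v \<notin> later xs v"
  by (induction xs) (use later_subset in auto)

lemma bij_betw_map_orderings: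
  assumes "bij_betw \<sigma> W W"
  shows "bij_betw (map \<sigma>) (orderings W) (orderings W)"
proof (rule bij_betw_byWitness[where f' = "map (inv_into W \<sigma>)"])
  have inj: "inj_on \<sigma> W" and im: "\<sigma> ` W = W" using assms by (auto simp: bij_betw_def)
  show "map \<sigma> ` orderings W \<subseteq> orderings W"
    using inj im by (auto simp: orderings_def distinct_map)
  have "bij_betw (inv_into W \<sigma>) W W" by (rule bij_betw_inv_into[OF assms])
  then show "map (inv_into W \<sigma>) ` orderings W \<subseteq> orderings W"
    by (auto simp: orderings_def distinct_map bij_betw_def)
  show "\<forall>xs\<in>orderings W. map (inv_into W \<sigma>) (map \<sigma> xs) = xs"
    using inj by (auto simp: orderings_def intro!: map_idI)
  show "\<forall>xs\<in>orderings W. map \<sigma> (map (inv_into W \<sigma>) xs) = xs"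
    using im by (auto simp: orderings_def f_inv_into_f intro!: map_idI)
qed

text \<open>A permutation of \<open>W\<close> permutes the orderings and carries the predecessors of
  \<open>v\<close> to those of \<open>\<sigma> v\<close>.\<close>

lemma sum_orderings_relabel:
  assumes "bij_betw \<sigma> W W" "M \<subseteq> W" "\<sigma> ` M = M" "v \<in> W"
  shows "(\<Sum>xs\<in>orderings W. \<phi> (later xs (\<sigma> v) \<inter> M)) = (\<Sum>xs\<in>orderings W. \<phi> (\<sigma> ` (later xs v \<inter> M)))"
proof -
  have inj: "inj_on \<sigma> W" using assms(1) by (simp add: bij_betw_def)
  have "(\<Sum>xs\<in>orderings W. \<phi> (later xs (\<sigma> v) \<inter> M))
      = (\<Sum>xs\<in>orderings W. \<phi> (later (map \<sigma> xs) (\<sigma> v) \<inter> M))"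
    by (rule sum.reindex_bij_betw[OF bij_betw_map_orderings[OF assms(1)], symmetric])
  also have "\<dots> = (\<Sum>xs\<in>orderings W. \<phi> (\<sigma> ` (later xs v \<inter> M)))"
  proof (rule sum.cong[OF refl])
    fix xs assume xs: "xs \<in> orderings W"
    have "insert v (set xs) = W" using xs assms(4) by (auto simp: orderings_def)
    then have "later (map \<sigma> xs) (\<sigma> v) = \<sigma> ` later xs v" using inj by (intro later_map) simp
    moreover have "later xs v \<subseteq> W" using xs later_subset[of xs v] by (simp add: orderings_def)
    then have "\<sigma> ` (later xs v \<inter> M) = \<sigma> ` later xs v \<inter> \<sigma> ` M"
      using inj_on_image_Int[OF inj _ assms(2)] by blast
    ultimately show "\<phi> (later (map \<sigma> xs) (\<sigma> v) \<inter> M) = \<phi> (\<sigma> ` (later xs v \<inter> M))"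
      using assms(3) by simp
  qed
  finally show ?thesis .
qed

text \<open>By symmetry \<open>v\<close> may be averaged over \<open>insert v N\<close>, and within
  each order the counts for these vertices run through 0, ..., |N| exactly once. So the number of
  earlier vertices of \<open>N\<close> is uniformly distributed.\<close>

lemma sum_orderings_card_later:
  fixes \<psi> :: "nat \<Rightarrow> real"
  assumes "finite W" "v \<in> W" "N \<subseteq> W - {v}"
  shows "real (card N + 1) * (\<Sum>xs\<in>orderings W. \<psi> (card (later xs v \<inter> N)))
    = real (card (orderings W)) * (\<Sum>k\<le>card N. \<psi> k)"
proof -
  let ?M = "insert v N"
  have fN: "finite N" "v \<notin> N" using assms finite_subset[of N "W - {v}"] by auto
  have MW: "?M \<subseteq> W" using assms by auto
  have eq: "(\<Sum>xs\<in>orderings W. \<psi> (card (later xs w \<inter> ?M))) = (\<Sum>xs\<in>orderings W. \<psi> (card (later xs v \<inter> ?M)))"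
    if "w \<in> ?M" for w
  proof -
    \<comment> \<open>The transposition of \<open>v\<close> and \<open>w\<close> preserves
      \<open>insert v N\<close>.\<close>
    let ?\<sigma> = "\<lambda>u. if u = v then w else if u = w then v else u"
    have bij: "bij_betw ?\<sigma> W W"
      by (rule bij_betw_byWitness[where f' = ?\<sigma>]) (use that MW in auto)
    have im: "?\<sigma> ` ?M = ?M"
      using that by (auto simp: image_iff)
    have "card (?\<sigma> ` A) = card A" for A
      by (rule card_image) (auto simp: inj_on_def)
    then show ?thesis
      using sum_orderings_relabel[OF bij MW im assms(2), of "\<lambda>A. \<psi> (card A)"] by simp
  qed
  have "real (card N + 1) * (\<Sum>xs\<in>orderings W. \<psi> (card (later xs v \<inter> ?M)))
      = (\<Sum>w\<in>?M. \<Sum>xs\<in>orderings W. \<psi> (card (later xs w \<inter> ?M)))"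
    using sum.cong[OF refl eq, of ?M "\<lambda>w. w"] fN by simp
  also have "\<dots> = (\<Sum>xs\<in>orderings W. \<Sum>w\<in>?M. \<psi> (card (later xs w \<inter> ?M)))"
    by (rule sum.swap)
  also have "\<dots> = (\<Sum>xs\<in>orderings W. \<Sum>k\<le>card N. \<psi> k)"
  proof (rule sum.cong[OF refl])
    fix xs assume xs: "xs \<in> orderings W"
    then have "set xs \<inter> ?M = ?M" "distinct xs" using MW by (auto simp: orderings_def)
    then have "bij_betw (\<lambda>w. card (later xs w \<inter> ?M)) ?M {..<card ?M}"
      using bij_betw_card_later[of xs ?M] by simp
    from sum.reindex_bij_betw[OF this, of \<psi>]
    show "(\<Sum>w\<in>?M. \<psi> (card (later xs w \<inter> ?M))) = (\<Sum>k\<le>card N. \<psi> k)"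
      using fN by (simp add: lessThan_Suc_atMost)
  qed
  also have "\<dots> = real (card (orderings W)) * (\<Sum>k\<le>card N. \<psi> k)" by simp
  finally have "real (card N + 1) * (\<Sum>xs\<in>orderings W. \<psi> (card (later xs v \<inter> ?M)))
      = real (card (orderings W)) * (\<Sum>k\<le>card N. \<psi> k)" .
  moreover have "later xs v \<inter> ?M = later xs v \<inter> N" if "xs \<in> orderings W" for xs
    using later_irrefl[of xs v] that by (auto simp: orderings_def)
  ultimately show ?thesis by simp
qed

text \<open>Glue bijections from \<open>A\<close> to \<open>B\<close> and from \<open>N - A\<close>
  to \<open>N - B\<close> with the identity outside \<open>N\<close>. This is the symmetry that
  makes all subsets of \<open>N\<close> of equal size equally likely.\<close>

lemma exists_bij_betw_swap:
  assumes "finite N" "A \<subseteq> N" "B \<subseteq> N" "card A = card B" "N \<subseteq> W - {v}"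
  obtains \<sigma> where "bij_betw \<sigma> W W" "\<sigma> v = v" "\<sigma> ` A = B" "\<sigma> ` N = N"
proof -
  have fAB: "finite A" "finite B" using assms(1-3) finite_subset by blast+
  then obtain f where f: "bij_betw f A B" using assms(4) finite_same_card_bij by blast
  have "card (N - A) = card (N - B)" using assms fAB by (simp add: card_Diff_subset)
  then obtain g where g: "bij_betw g (N - A) (N - B)"
    using assms(1) finite_same_card_bij[of "N - A" "N - B"] by blast
  let ?\<sigma> = "\<lambda>u. if u \<in> A then f u else if u \<in> N then g u else u"
  have A: "bij_betw ?\<sigma> A B" using f by (subst bij_betw_cong[where g = f]) auto
  have NA: "bij_betw ?\<sigma> (N - A) (N - B)" using g by (subst bij_betw_cong[where g = g]) auto
  have WN: "bij_betw ?\<sigma> (W - N) (W - N)"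
    using assms(2) by (subst bij_betw_cong[where g = id]) auto
  have "bij_betw ?\<sigma> (A \<union> (N - A)) (B \<union> (N - B))"
    by (rule bij_betw_combine[OF A NA]) auto
  then have N: "bij_betw ?\<sigma> N N" using assms(2,3) by (simp add: Un_absorb1)
  have "bij_betw ?\<sigma> (N \<union> (W - N)) (N \<union> (W - N))"
    by (rule bij_betw_combine[OF N WN]) auto
  moreover have "N \<union> (W - N) = W" using assms(5) by auto
  ultimately have "bij_betw ?\<sigma> W W" by simp
  moreover have "?\<sigma> v = v" using assms(2,5) by auto
  ultimately show ?thesis using that[of ?\<sigma>] A N by (simp add: bij_betw_def)
qed

text \<open>The size of the set of earlier neighbours is uniform on |N| + 1 values, and for a given
  size all subsets are equally likely by symmetry.\<close>

lemma card_orderings_later_eq: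
  assumes "finite W" "v \<in> W" "N \<subseteq> W - {v}" "A \<subseteq> N"
  shows "real (card {xs \<in> orderings W. later xs v \<inter> N = A}) * (real (card N + 1) * real (card N choose card A))
    = real (card (orderings W))"
proof -
  let ?O = "orderings W" and ?k = "card A"
  let ?cnt = "\<lambda>B. card {xs \<in> ?O. later xs v \<inter> N = B}"
  let ?S = "{B. B \<subseteq> N \<and> card B = ?k}"
  have fN: "finite N" using assms finite_subset[of N "W - {v}"] by simp
  have fO: "finite ?O" using assms(1) by (rule finite_orderings)
  have cnt: "?cnt B = (\<Sum>xs\<in>?O. if later xs v \<inter> N = B then 1 else 0)" for B
    using fO by (simp add: sum.If_cases Int_def)
  have same: "?cnt B = ?cnt A" if B: "B \<in> ?S" for B
  proof -
    obtain \<sigma> where \<sigma>: "bij_betw \<sigma> W W" "\<sigma> v = v" "\<sigma> ` A = B" "\<sigma> ` N = N"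
      using exists_bij_betw_swap[OF fN assms(4) _ _ assms(3), of B] B by auto
    have inj: "inj_on \<sigma> N" using \<sigma>(1) assms(3) by (auto simp: bij_betw_def intro: inj_on_subset)
    have image_eq: "\<sigma> ` C = B \<longleftrightarrow> C = A" if "C \<subseteq> N" for C
      using \<sigma>(3) inj_on_image_eq_iff[OF inj that assms(4)] by auto
    have "\<sigma> ` (later xs v \<inter> N) = B \<longleftrightarrow> later xs v \<inter> N = A" for xs
      by (rule image_eq) simp
    moreover have "N \<subseteq> W" using assms(3) by auto
    ultimately show ?thesis
      unfolding cnt using sum_orderings_relabel[OF \<sigma>(1) _ \<sigma>(4) assms(2), of "\<lambda>C. if C = B then 1 else (0::nat)"]
      by (simp add: \<sigma>(2))
  qed
  have "{xs \<in> ?O. card (later xs v \<inter> N) = ?k} = (\<Union>B\<in>?S. {xs \<in> ?O. later xs v \<inter> N = B})" by auto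
  then have "card {xs \<in> ?O. card (later xs v \<inter> N) = ?k} = (\<Sum>B\<in>?S. ?cnt B)"
    using fN fO by (simp only:) (rule card_UN_disjoint, auto)
  also have "\<dots> = ?cnt A * (card N choose ?k)"
    using same fN by (simp add: n_subsets)
  finally have 1: "real (card {xs \<in> ?O. card (later xs v \<inter> N) = ?k}) = real (?cnt A) * real (card N choose ?k)"
    by simp
  have "real (card N + 1) * (\<Sum>xs\<in>?O. if card (later xs v \<inter> N) = ?k then 1 else 0)
      = real (card ?O) * (\<Sum>j\<le>card N. if j = ?k then 1 else 0)"
    by (rule sum_orderings_card_later[OF assms(1-3)])
  moreover have "?k \<le> card N" using assms(4) fN by (simp add: card_mono)
  ultimately have "real (card N + 1) * real (card {xs \<in> ?O. card (later xs v \<inter> N) = ?k}) = real (card ?O)"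
    using fO by (simp add: sum.If_cases Int_def)
  then show ?thesis unfolding 1 by (simp add: mult_ac)
qed

text \<open>With D = |N|, at most \<open>(D - 1) choose k\<close> of the \<open>D choose k\<close>
  subsets are cliques, so a fraction of at least k/D is not. Size \<open>k\<close> itself has
  probability 1/(D + 1).\<close>

lemma card_orderings_non_clique_ge:
  assumes W: "finite W" "v \<in> W" "N \<subseteq> W - {v}"
    and N: "diamond_free H N" "\<not> clique H N" and k: "4 \<le> k" "k \<le> card N"
  shows "real (card (orderings W)) * k \<le> (card N * (card N + 1)) *
    real (card {xs \<in> orderings W. card (later xs v \<inter> N) = k \<and> \<not> clique H (later xs v \<inter> N)})"
proof -
  let ?O = "orderings W" and ?D = "card N"
  let ?cnt = "\<lambda>B. card {xs \<in> ?O. later xs v \<inter> N = B}"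
  let ?C = "{B. B \<subseteq> N \<and> card B = k \<and> clique H B}" and ?T = "{B. B \<subseteq> N \<and> card B = k \<and> \<not> clique H B}"
  have fN: "finite N" using W finite_subset[of N "W - {v}"] by simp
  have fO: "finite ?O" using W(1) by (rule finite_orderings)
  have "{B. B \<subseteq> N \<and> card B = k} = ?C \<union> ?T" by auto
  then have "?D choose k = card (?C \<union> ?T)" using n_subsets[OF fN, of k] by simp
  also have "\<dots> = card ?C + card ?T" using fN by (intro card_Un_disjoint) auto
  finally have "?D choose k \<le> ((?D - 1) choose k) + card ?T"
    using card_cliques_le[OF fN N k(1)] by linarith
  moreover have "?D choose k = ((?D - 1) choose (k - 1)) + ((?D - 1) choose k)"
    using k by (intro choose_reduce_nat) auto
  ultimately have T: "(?D - 1) choose (k - 1) \<le> card ?T" by linarith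
  have "k * (?D choose k) = ?D * ((?D - 1) choose (k - 1))"
    using k by (intro times_binomial_minus1_eq) auto
  then have kD: "k * (?D choose k) \<le> ?D * card ?T" using T by simp
  have "{xs \<in> ?O. card (later xs v \<inter> N) = k \<and> \<not> clique H (later xs v \<inter> N)}
      = (\<Union>B\<in>?T. {xs \<in> ?O. later xs v \<inter> N = B})" by auto
  then have X: "card {xs \<in> ?O. card (later xs v \<inter> N) = k \<and> \<not> clique H (later xs v \<inter> N)} = (\<Sum>B\<in>?T. ?cnt B)"
    (is "?X = _")
    using fN fO by (simp only:) (rule card_UN_disjoint, auto)
  have "real ?X * (real (?D + 1) * real (?D choose k))
      = (\<Sum>B\<in>?T. real (?cnt B) * (real (?D + 1) * real (?D choose k)))"
    unfolding X by (simp add: sum_distrib_right)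
  also have "\<dots> = (\<Sum>B\<in>?T. real (card ?O))"
    by (rule sum.cong) (use card_orderings_later_eq[OF W] in auto)
  finally have eq: "real ?X * (real (?D + 1) * real (?D choose k)) = real (card ?T) * real (card ?O)" by simp
  have "real k * real (?D choose k) \<le> real ?D * real (card ?T)"
    using of_nat_mono[OF kD, where 'a = real] by (simp only: of_nat_mult)
  then have "real (card ?O) * (real k * real (?D choose k)) \<le> real (card ?O) * (real ?D * real (card ?T))"
    by (intro mult_left_mono) auto
  also have "\<dots> = real ?D * (real ?X * (real (?D + 1) * real (?D choose k)))"
    unfolding eq by (simp only: mult_ac)
  finally have "(real (card ?O) * k) * real (?D choose k)
      \<le> (real (?D * (?D + 1)) * real ?X) * real (?D choose k)"
    by (simp only: mult_ac of_nat_mult)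
  moreover have "0 < real (?D choose k)" using k by simp
  ultimately show ?thesis by (rule mult_right_le_imp_le)
qed

section \<open>Expected gain of a vertex\<close>

lemma sum_min_3: "2 \<le> D \<Longrightarrow> (\<Sum>k\<le>D. real (min k 3)) = 3 * real D - 3"
proof (induction D rule: dec_induct)
  case base
  then show ?case by (simp add: eval_nat_numeral)
qed simp

lemma sum_from_4: "3 \<le> D \<Longrightarrow> (\<Sum>k=4..D. real k) = real D * (real D + 1) / 2 - 6"
  by (induction D rule: dec_induct) (simp_all add: field_simps)

text \<open>For \<open>k\<close> uniform on 0, ..., D the mean of \<open>min k 3\<close> is (3D -
  3)/(D + 1).\<close>

lemma sum_orderings_min_card:
  assumes "finite W" "v \<in> W" "N \<subseteq> W - {v}" "2 \<le> card N"
  shows "(\<Sum>xs\<in>orderings W. real (min (card (later xs v \<inter> N)) 3))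
    = real (card (orderings W)) * (3 - 6 / (real (card N) + 1))"
  using sum_orderings_card_later[OF assms(1-3), of "\<lambda>k. real (min k 3)"]
  unfolding sum_min_3[OF assms(4)] by (simp add: field_simps)

lemma sum_orderings_gain_ge:
  assumes "finite W" "v \<in> W" "N \<subseteq> W - {v}" "2 \<le> card N"
  shows "real (card (orderings W)) * (3 - 6 / (real (card N) + 1))
    \<le> (\<Sum>xs\<in>orderings W. real (gain H (later xs v \<inter> N)))"
  unfolding sum_orderings_min_card[OF assms, symmetric]
  by (intro sum_mono) (auto simp: gain_def)

text \<open>The gain is \<open>min k 3\<close> plus 1 when the earlier neighbours number at least
  four and form no clique. These indicators have means of at least k/(D(D + 1)), with total at least
  1/2 - 6/(D(D + 1)), and 6/(D + 1) + 6/(D(D + 1)) = 6/D.\<close>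

lemma sum_orderings_gain_non_clique_ge:
  assumes W: "finite W" "v \<in> W" "N \<subseteq> W - {v}"
    and N: "diamond_free H N" "\<not> clique H N" "4 \<le> card N"
  shows "real (card (orderings W)) * (7 / 2 - 6 / real (card N))
    \<le> (\<Sum>xs\<in>orderings W. real (gain H (later xs v \<inter> N)))"
proof -
  let ?O = "orderings W" and ?D = "card N" and ?L = "\<lambda>xs. later xs v \<inter> N"
  let ?ind = "\<lambda>k xs. if card (?L xs) = k \<and> \<not> clique H (?L xs) then 1 else 0 :: real"
  have fN: "finite N" using W finite_subset[of N "W - {v}"] by simp
  have fO: "finite ?O" using W(1) by (rule finite_orderings)
  have gain: "real (min (card (?L xs)) 3) + (\<Sum>k=4..?D. ?ind k xs) = real (gain H (?L xs))" for xs
  proof -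
    have "card (?L xs) \<le> ?D" using fN by (intro card_mono) auto
    moreover have "(\<Sum>k=4..?D. ?ind k xs)
        = (\<Sum>k=4..?D. if k = card (?L xs) then (if \<not> clique H (?L xs) then 1 else 0) else 0)"
      by (rule sum.cong) auto
    ultimately show ?thesis by (auto simp: gain_def)
  qed
  have "real (card ?O) * (k / (?D * (?D + 1))) \<le> (\<Sum>xs\<in>?O. ?ind k xs)" if k: "k \<in> {4..?D}" for k
  proof -
    have "(\<Sum>xs\<in>?O. ?ind k xs) = real (card {xs \<in> ?O. card (?L xs) = k \<and> \<not> clique H (?L xs)})"
      using fO by (simp add: sum.If_cases Int_def)
    moreover have "0 < real (?D * (?D + 1))"
      by (subst of_nat_0_less_iff) (use N(3) in auto)
    ultimately show ?thesis
      using card_orderings_non_clique_ge[OF W N(1,2), of k] k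
      by (simp add: pos_divide_le_eq mult.commute)
  qed
  then have "(\<Sum>k=4..?D. real (card ?O) * (k / (?D * (?D + 1)))) \<le> (\<Sum>k=4..?D. \<Sum>xs\<in>?O. ?ind k xs)"
    by (rule sum_mono)
  also have "\<dots> = (\<Sum>xs\<in>?O. \<Sum>k=4..?D. ?ind k xs)" by (rule sum.swap)
  finally have 1: "(\<Sum>k=4..?D. real (card ?O) * (k / (?D * (?D + 1)))) \<le> (\<Sum>xs\<in>?O. \<Sum>k=4..?D. ?ind k xs)" .
  have "(\<Sum>k=4..?D. real (card ?O) * (k / (?D * (?D + 1))))
      = real (card ?O) * ((\<Sum>k=4..?D. real k) / (?D * (?D + 1)))"
    by (simp add: sum_distrib_left sum_divide_distrib)
  also have "(\<Sum>k=4..?D. real k) / (?D * (?D + 1)) = 1 / 2 - 6 / (real ?D * (real ?D + 1))"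
  proof -
    have "(u / 2 - 6) / u = 1 / 2 - 6 / u" if "u \<noteq> 0" for u :: real
      using that by (simp add: diff_divide_distrib)
    from this[of "real ?D * (real ?D + 1)"] show ?thesis
      using N(3) sum_from_4[of ?D] by (simp only: of_nat_mult of_nat_add of_nat_1) force
  qed
  finally have "real (card ?O) * (1 / 2 - 6 / (real ?D * (real ?D + 1))) \<le> (\<Sum>xs\<in>?O. \<Sum>k=4..?D. ?ind k xs)"
    using 1 by simp
  moreover have split: "7 / 2 - 6 / real ?D = (3 - 6 / (real ?D + 1)) + (1 / 2 - 6 / (real ?D * (real ?D + 1)))"
  proof -
    have "6 / u = 6 / (u + 1) + 6 / (u * (u + 1))" if "0 < u" for u :: real
    proof -
      have "6 / (u + 1) = 6 * u / (u * (u + 1))" using that by simp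
      then have "6 / (u + 1) + 6 / (u * (u + 1)) = 6 * (u + 1) / (u * (u + 1))"
        by (simp only: add_divide_distrib[symmetric] distrib_left mult_1_right)
      also have "\<dots> = 6 / u" using that by (intro mult_divide_mult_cancel_right) simp
      finally show ?thesis by simp
    qed
    from this[of "real ?D"] show ?thesis using N(3) by simp
  qed
  ultimately have "real (card ?O) * (7 / 2 - 6 / real ?D)
      \<le> (\<Sum>xs\<in>?O. real (min (card (?L xs)) 3)) + (\<Sum>xs\<in>?O. \<Sum>k=4..?D. ?ind k xs)"
    using sum_orderings_min_card[OF W] N(3) unfolding split distrib_left by simp
  also have "\<dots> = (\<Sum>xs\<in>?O. real (gain H (?L xs)))"
    unfolding sum.distrib[symmetric] gain ..
  finally show ?thesis .
qed

section \<open>Highly connected graphs\<close>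

text \<open>Connectivity in terms of cuts, relative to a vertex set \<open>W\<close>: only edges of
  \<open>J\<close> inside \<open>W\<close> matter, so one edge set serves all induced
  subgraphs.\<close>

definition k_connected_on :: "nat \<Rightarrow> 'a set \<Rightarrow> 'a set set \<Rightarrow> bool" where
  "k_connected_on k W J \<longleftrightarrow> k + 1 \<le> card W \<and>
     (\<forall>X A. X \<subseteq> W \<longrightarrow> card X < k \<longrightarrow> A \<subseteq> W - X \<longrightarrow> A \<noteq> {} \<longrightarrow> A \<noteq> W - X \<longrightarrow>
       (\<exists>a\<in>A. \<exists>b\<in>W - X - A. {a, b} \<in> J))"

lemma k_connected_onD:
  assumes "k_connected_on k W J" "X \<subseteq> W" "card X < k" "A \<subseteq> W - X" "A \<noteq> {}" "A \<noteq> W - X"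
  obtains a b where "a \<in> A" "b \<in> W - X - A" "{a, b} \<in> J"
  using assms unfolding k_connected_on_def by meson

lemma k_connected_imp_on:
  assumes "k_connected k n F" "F \<subseteq> J"
  shows "k_connected_on k {..<n} J"
  unfolding k_connected_on_def
proof (intro conjI allI impI)
  show "k + 1 \<le> card {..<n}" using assms(1) by (simp add: k_connected_def)
  fix X A assume X: "X \<subseteq> {..<n}" "card X < k" and A: "A \<subseteq> {..<n} - X" "A \<noteq> {}" "A \<noteq> {..<n} - X"
  obtain u w where u: "u \<in> A" and w: "w \<in> {..<n} - X" "w \<notin> A" using A by blast
  let ?R = "\<lambda>a b. a \<in> {0..<n} - X \<and> b \<in> {0..<n} - X \<and> {a, b} \<in> F"
  have "connected_minus n F X" using assms(1) X by (simp add: k_connected_def atLeast0LessThan)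
  then have "?R\<^sup>*\<^sup>* u w" using u w A(1) unfolding connected_minus_def atLeast0LessThan by blast
  \<comment> \<open>Along the path from \<open>u\<close>, either the current vertex is still in
    \<open>A\<close> or an edge has already crossed the cut.\<close>
  then have "w \<in> A \<or> (\<exists>a\<in>A. \<exists>b\<in>{..<n} - X - A. {a, b} \<in> F)"
  proof induction
    case base
    then show ?case using u by blast
  next
    case (step b c)
    then show ?case by (auto simp: atLeast0LessThan)
  qed
  then show "\<exists>a\<in>A. \<exists>b\<in>{..<n} - X - A. {a, b} \<in> J" using w assms(2) by blast
qed

text \<open>Deleting all neighbours of \<open>v\<close> would isolate it from the at least one
  remaining vertex.\<close>

lemma k_connected_on_degree:
  assumes "k_connected_on k W J" "finite W" "v \<in> W"
  shows "k \<le> card (nbrs J v \<inter> (W - {v}))"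
proof (rule ccontr)
  let ?X = "nbrs J v \<inter> (W - {v})"
  assume "\<not> k \<le> card ?X"
  then have less: "card ?X < k" by simp
  have "k + 1 \<le> card W" using assms(1) by (simp add: k_connected_on_def)
  then have "card (W - ?X) \<ge> 2"
    using less assms(2) by (subst card_Diff_subset) auto
  then have "{v} \<noteq> W - ?X" by auto
  then obtain b where "b \<in> W - ?X - {v}" "{v, b} \<in> J"
    using k_connected_onD[OF assms(1) _ less, of "{v}"] assms(3) by blast
  then show False by (auto simp: nbrs_def)
qed

text \<open>If the neighbours of \<open>v\<close> meet both sides of a cut of
  \<open>W - {v}\<close>, two of them give a crossing edge. Otherwise \<open>v\<close> joins a side
  so that none of its edges cross, and the connectivity of \<open>W\<close> supplies the crossing
  edge.\<close>

lemma k_connected_on_delete: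
  assumes conn: "k_connected_on k W J" and fin: "finite W" and v: "v \<in> W"
    and simplicial: "clique J (nbrs J v \<inter> (W - {v}))" and large: "k + 1 \<le> card (W - {v})"
  shows "k_connected_on k (W - {v}) J"
  unfolding k_connected_on_def
proof (intro conjI allI impI)
  let ?N = "nbrs J v \<inter> (W - {v})"
  show "k + 1 \<le> card (W - {v})" by (rule large)
  fix X A assume X: "X \<subseteq> W - {v}" "card X < k"
    and A: "A \<subseteq> W - {v} - X" "A \<noteq> {}" "A \<noteq> W - {v} - X"
  let ?B = "W - {v} - X - A"
  show "\<exists>a\<in>A. \<exists>b\<in>?B. {a, b} \<in> J"
  proof (cases "?N \<inter> A = {}")
    case True
    obtain a b where ab: "a \<in> A" "b \<in> W - X - A" "{a, b} \<in> J"
      using k_connected_onD[OF conn _ X(2), of A] X(1) A v by blast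
    have "b \<noteq> v" using ab(1,3) A(1) True by (auto simp: nbrs_def insert_commute)
    then show ?thesis using ab by blast
  next
    case False
    then obtain a where a: "a \<in> ?N" "a \<in> A" by blast
    show ?thesis
    proof (cases "?N \<inter> ?B = {}")
      case True
      obtain c b where cb: "c \<in> insert v A" "b \<in> W - X - insert v A" "{c, b} \<in> J"
        using k_connected_onD[OF conn _ X(2), of "insert v A"] X(1) A v by blast
      have "c \<noteq> v" using cb(2,3) True by (auto simp: nbrs_def)
      then show ?thesis using cb by blast
    next
      case False
      then obtain b where b: "b \<in> ?N" "b \<in> ?B" by blast
      have "a \<noteq> b" using a(2) b(2) by blast
      then have "{a, b} \<in> J" using simplicial[unfolded clique_def] a(1) b(1) by (elim ballE) auto
      then show ?thesis using a b by blast
    qed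
  qed
qed

lemma card_nbrs_le_card_edges:
  assumes "finite S"
  shows "card (nbrs S v \<inter> W) \<le> card {e \<in> S. v \<in> e}"
  by (rule card_inj_on_le[of "\<lambda>u. {v, u}"])
    (use assms in \<open>auto simp: nbrs_def inj_on_def doubleton_eq_iff\<close>)

lemma sum_card_nbrs_le:
  assumes "S \<subseteq> Kn_edges n" "finite W"
  shows "(\<Sum>v\<in>W. card (nbrs S v \<inter> W)) \<le> 2 * card S"
proof -
  have fS: "finite S" using assms(1) finite_Kn_edges finite_subset by blast
  have "(\<Sum>v\<in>W. card (nbrs S v \<inter> W)) \<le> (\<Sum>v\<in>W. card {e \<in> S. v \<in> e})"
    by (intro sum_mono card_nbrs_le_card_edges fS)
  also have "\<dots> = (\<Sum>e\<in>S. card {v \<in> W. v \<in> e})"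
    by (rule sum_multicount_gen[OF assms(2) fS]) simp
  also have "\<dots> \<le> (\<Sum>e\<in>S. 2)"
  proof (rule sum_mono)
    fix e assume "e \<in> S"
    then obtain a b where e: "e = {a, b}" "a \<noteq> b" using assms(1) by (blast elim: Kn_edgesE)
    then have "card {v \<in> W. v \<in> e} \<le> card {a, b}" by (intro card_mono) auto
    then show "card {v \<in> W. v \<in> e} \<le> 2" using e(2) by simp
  qed
  finally show ?thesis by simp
qed

section \<open>The minimal counterexample\<close>

text \<open>Together with \<open>v\<close>, a \<open>K_4\<close> minus an edge in the neighbourhood
  becomes \<open>K_5\<close> minus an edge, which closedness completes.\<close>

lemma diamond_free_nbrs:
  assumes gen: "generic_config n x y" and H: "H = cof_closure n x y X"
  shows "diamond_free H (nbrs H v)"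
  unfolding diamond_free_def
proof (intro ballI impI)
  fix a b p q
  assume mem: "a \<in> nbrs H v" "b \<in> nbrs H v" "p \<in> nbrs H v" "q \<in> nbrs H v"
    and d: "distinct [a, b, p, q]"
    and e: "{p, q} \<in> H" "{p, a} \<in> H" "{q, a} \<in> H" "{p, b} \<in> H" "{q, b} \<in> H"
  have ne: "u \<noteq> v" "u < n" if "u \<in> nbrs H v" for u
    using that by (auto simp: nbrs_def H cof_closure_def)
  show "{a, b} \<in> H"
    by (rule cof_closure_K5[OF gen H, of a b p q v])
      (use mem d e ne in \<open>auto simp: nbrs_def insert_commute\<close>)
qed

text \<open>The claim amounts to 12 \<le> s(D + 1). If s = 1 then D \<ge> 11, with equality
  possible; if s \<ge> 2 then D \<ge> 6 suffices. It fails for s = 0, so a simplicial vertex has to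
  meet \<open>S\<close>.\<close>

lemma expected_gain_bound_simplicial:
  fixes D s :: nat
  assumes "1 \<le> s" "s \<le> 6" "12 \<le> D + s"
  shows "3 - real s / 2 \<le> 3 - 6 / (real D + 1)"
proof -
  have "12 \<le> s * (D + 1)"
  proof (cases "s = 1")
    case False
    then have "2 * 7 \<le> s * (D + 1)" using assms by (intro mult_mono) auto
    then show ?thesis by simp
  qed (use assms in simp)
  then have "12 \<le> real s * (real D + 1)" by (metis of_nat_1 of_nat_add of_nat_le_iff of_nat_mult of_nat_numeral)
  then show ?thesis by (simp add: field_simps)
qed

text \<open>The claim amounts to 12 \<le> (s + 1)D, which follows from D \<ge> 12 if s = 0 and from
  D \<ge> 6 otherwise.\<close>

lemma expected_gain_bound:
  fixes D s :: nat
  assumes "s \<le> 6" "12 \<le> D + s"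
  shows "3 - real s / 2 \<le> 7 / 2 - 6 / real D"
proof -
  have "12 \<le> (s + 1) * D"
  proof (cases "s = 0")
    case False
    then have "2 * 6 \<le> (s + 1) * D" using assms by (intro mult_mono) auto
    then show ?thesis by simp
  qed (use assms in simp)
  then have "12 \<le> (real s + 1) * real D" by (metis of_nat_1 of_nat_add of_nat_le_iff of_nat_mult of_nat_numeral)
  moreover have "0 < real D" using assms by simp
  ultimately show ?thesis by (simp add: field_simps)
qed

lemma cof_closure_complete:
  assumes gen: "generic_config n x y" and H: "H = cof_closure n x y X"
    and S: "S \<subseteq> Kn_edges n" "card S \<le> 6"
    and conn: "k_connected_on 12 {..<n} (H \<union> S)"
  shows "clique H {..<n}"
proof (rule ccontr)
  let ?P = "\<lambda>W. W \<subseteq> {..<n} \<and> k_connected_on 12 W (H \<union> S) \<and> \<not> clique H W"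
  assume "\<not> clique H {..<n}"
  then have "?P {..<n}" using conn by simp
  then obtain W where P: "?P W" and min: "\<And>V. ?P V \<Longrightarrow> card W \<le> card V"
    using ex_has_least_nat[of ?P "{..<n}" card] by blast
  have W: "W \<subseteq> {..<n}" and connW: "k_connected_on 12 W (H \<union> S)" and ncW: "\<not> clique H W" using P by auto
  have fW: "finite W" using W finite_subset by blast
  have cardW: "13 \<le> card W" using connW by (simp add: k_connected_on_def)
  then have n: "4 \<le> n" using card_mono[OF _ W] by simp
  have fS: "finite S" using S(1) finite_Kn_edges finite_subset by blast
  have HK: "H \<subseteq> Kn_edges n" by (auto simp: H cof_closure_def)
  let ?N = "\<lambda>v. nbrs H v \<inter> W" and ?T = "\<lambda>v. nbrs S v \<inter> W" and ?O = "orderings W"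
  have loop: "v \<notin> nbrs H v" "v \<notin> nbrs S v" for v
    using HK S(1) Kn_edges_pair[of v v n] unfolding nbrs_def by blast+
  have J: "nbrs (H \<union> S) v \<inter> (W - {v}) = ?N v \<union> ?T v" for v
    using loop[of v] by (auto simp: nbrs_def)
  have deg: "12 \<le> card (?N v) + card (?T v)" if "v \<in> W" for v
    using k_connected_on_degree[OF connW fW that] card_Un_le[of "?N v" "?T v"] unfolding J by linarith
  have Tle: "card (?T v) \<le> 6" for v
  proof -
    have "card {e \<in> S. v \<in> e} \<le> card S" by (rule card_mono[OF fS]) auto
    then show ?thesis using card_nbrs_le_card_edges[OF fS, of v W] S(2) by linarith
  qed
  \<comment> \<open>If \<open>W - {v}\<close> is a clique of \<open>H\<close>, three neighbours of
    \<open>v\<close> and a non-neighbour \<open>a\<close> make \<open>K_5\<close> minus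
    \<open>va\<close>, which closes up. Otherwise deleting \<open>v\<close> contradicts the
    minimality of \<open>W\<close>.\<close>
  have not_simplicial: "card (?T v) \<noteq> 0" if v: "v \<in> W" and cl: "clique H (?N v)" for v
  proof
    assume "card (?T v) = 0"
    then have T: "?T v = {}" using fW by simp
    then have D: "12 \<le> card (?N v)" using deg[OF v] by simp
    show False
    proof (cases "clique H (W - {v})")
      case True
      obtain a where a: "a \<in> W" "a \<noteq> v" "{v, a} \<notin> H"
        using ncW True unfolding clique_def by (metis Diff_iff insert_commute singletonD)
      have "3 \<le> card (?N v)" using D by simp
      then obtain U where "U \<subseteq> ?N v" "card U = 3" by (rule obtain_subset_with_card_n)
      then obtain p q r where pqr: "p \<in> ?N v" "q \<in> ?N v" "r \<in> ?N v" "p \<noteq> q" "p \<noteq> r" "q \<noteq> r"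
        by (auto simp: card_3_iff)
      have ne: "u \<noteq> v" "u \<noteq> a" "u \<in> W" "{u, v} \<in> H" "{u, a} \<in> H" if "u \<in> ?N v" for u
      proof -
        show "u \<noteq> v" "u \<noteq> a" "u \<in> W" "{u, v} \<in> H"
          using that a(3) loop by (auto simp: nbrs_def insert_commute)
        then show "{u, a} \<in> H" using True a(1,2) unfolding clique_def by blast
      qed
      have cl': "{p, q} \<in> H" "{p, r} \<in> H" "{q, r} \<in> H"
        using cl pqr unfolding clique_def by blast+
      have "{v, a} \<in> H"
        by (rule cof_closure_K5[OF gen H, of v a p q r])
          (use pqr ne cl' a v W in auto)
      then show False using a(3) by blast
    next
      case False
      have "?N v \<subseteq> W - {v}" using loop by auto
      \<comment> \<open>With 13 vertices, the 12 neighbours would fill \<open>W - {v}\<close> and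
        make it a clique. Hence the deletion leaves the 13 vertices that 12-connectivity
        demands.\<close>
      then have "card W \<noteq> 13"
        using False cl D fW v card_subset_eq[of "W - {v}" "?N v"] card_mono[of "W - {v}" "?N v"] by auto
      then have "12 + 1 \<le> card (W - {v})" using cardW v by simp
      moreover have "clique (H \<union> S) (nbrs (H \<union> S) v \<inter> (W - {v}))"
        using cl unfolding J T by (auto simp: clique_def)
      ultimately have "k_connected_on 12 (W - {v}) (H \<union> S)"
        by (intro k_connected_on_delete[OF connW fW v])
      then have "card W \<le> card (W - {v})" using False W by (intro min) auto
      then show False using card_Diff1_less[OF fW v] by linarith
    qed
  qed
  have expected: "real (card ?O) * (3 - real (card (?T v)) / 2)
      \<le> (\<Sum>xs\<in>?O. real (gain H (later xs v \<inter> ?N v)))" if v: "v \<in> W" for v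
  proof -
    have N: "?N v \<subseteq> W - {v}" using loop by auto
    have D: "4 \<le> card (?N v)" using deg[OF v] Tle[of v] by linarith
    show ?thesis
    proof (cases "clique H (?N v)")
      case True
      then have "1 \<le> card (?T v)" using not_simplicial[OF v True] by linarith
      from expected_gain_bound_simplicial[OF this Tle deg[OF v]]
      have "real (card ?O) * (3 - real (card (?T v)) / 2)
          \<le> real (card ?O) * (3 - 6 / (real (card (?N v)) + 1))"
        by (rule mult_left_mono) simp
      also have "\<dots> \<le> (\<Sum>xs\<in>?O. real (gain H (later xs v \<inter> ?N v)))"
        by (rule sum_orderings_gain_ge[OF fW v N]) (use D in simp)
      finally show ?thesis .
    next
      case False
      have df: "diamond_free H (?N v)"
        using diamond_free_nbrs[OF gen H, of v] unfolding diamond_free_def by blast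
      from expected_gain_bound[OF Tle deg[OF v]]
      have "real (card ?O) * (3 - real (card (?T v)) / 2)
          \<le> real (card ?O) * (7 / 2 - 6 / real (card (?N v)))"
        by (rule mult_left_mono) simp
      also have "\<dots> \<le> (\<Sum>xs\<in>?O. real (gain H (later xs v \<inter> ?N v)))"
        by (rule sum_orderings_gain_non_clique_ge[OF fW v N df False D])
      finally show ?thesis .
    qed
  qed
  \<comment> \<open>The bound is one below the maximal rank 3|W| - 6, because some non-edge
    \<open>ab\<close> of \<open>H\<close> can still be added to \<open>B\<close>.\<close>
  have rank: "(\<Sum>v\<in>W. real (gain H (later xs v \<inter> ?N v))) \<le> 3 * real (card W) - 7" if xs: "xs \<in> ?O" for xs
  proof -
    have dxs: "distinct xs" "set xs = W" using xs by (auto simp: orderings_def)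
    then obtain B where B: "B \<subseteq> H" "\<forall>e\<in>B. e \<subseteq> W" "lin_indep B (cof_row x y)"
        "card B = (\<Sum>v\<in>W. gain H (nbrs H v \<inter> later xs v))"
      using lin_indep_ordering[OF gen n H dxs(1)] W by auto
    obtain a b where ab: "a \<in> W" "b \<in> W" "a \<noteq> b" "{a, b} \<notin> H" using ncW by (auto simp: clique_def)
    have BK: "B \<subseteq> Kn_edges n" using B(1) HK by blast
    have abK: "{a, b} \<in> Kn_edges n" using ab W by auto
    have "card (insert {a, b} B) + 6 \<le> 3 * card W"
    proof (rule card_lin_indep_le[OF gen W])
      show "lin_indep (insert {a, b} B) (cof_row x y)"
        by (rule lin_indep_insert_cof_closure[of _ n x y X]) (use B ab abK H in auto)
      show "3 \<le> card W" using cardW by simp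
      show "insert {a, b} B \<subseteq> Kn_edges n" using abK BK by blast
      show "e \<subseteq> W" if "e \<in> insert {a, b} B" for e using that B(2) ab by blast
    qed
    moreover have "card (insert {a, b} B) = Suc (card B)"
      using B(1) ab(4) BK finite_Kn_edges by (intro card_insert_disjoint) (auto intro: finite_subset)
    ultimately have "card B + 7 \<le> 3 * card W" by linarith
    moreover have "nbrs H v \<inter> later xs v = later xs v \<inter> ?N v" for v
      using later_subset[of xs v] dxs(2) by blast
    ultimately have "(\<Sum>v\<in>W. gain H (later xs v \<inter> ?N v)) + 7 \<le> 3 * card W" using B(4) by simp
    then have "real ((\<Sum>v\<in>W. gain H (later xs v \<inter> ?N v)) + 7) \<le> real (3 * card W)"
      by (rule of_nat_mono)
    then show ?thesis by simp
  qed
  have "real (card ?O) * (\<Sum>v\<in>W. 3 - real (card (?T v)) / 2)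
      = (\<Sum>v\<in>W. real (card ?O) * (3 - real (card (?T v)) / 2))" by (rule sum_distrib_left)
  also have "\<dots> \<le> (\<Sum>v\<in>W. \<Sum>xs\<in>?O. real (gain H (later xs v \<inter> ?N v)))"
    by (rule sum_mono[OF expected])
  also have "\<dots> = (\<Sum>xs\<in>?O. \<Sum>v\<in>W. real (gain H (later xs v \<inter> ?N v)))" by (rule sum.swap)
  also have "\<dots> \<le> (\<Sum>xs\<in>?O. 3 * real (card W) - 7)" by (rule sum_mono[OF rank])
  also have "\<dots> = real (card ?O) * (3 * real (card W) - 7)" by simp
  finally have "real (card ?O) * (\<Sum>v\<in>W. 3 - real (card (?T v)) / 2)
      \<le> real (card ?O) * (3 * real (card W) - 7)" .
  moreover have "0 < real (card ?O)"
    using finite_orderings[OF fW] orderings_nonempty[OF fW] by (simp add: card_gt_0_iff)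
  ultimately have "(\<Sum>v\<in>W. 3 - real (card (?T v)) / 2) \<le> 3 * real (card W) - 7"
    by (rule mult_left_le_imp_le)
  moreover have "(\<Sum>v\<in>W. 3 - real (card (?T v)) / 2)
      = 3 * real (card W) - real (\<Sum>v\<in>W. card (?T v)) / 2"
    by (simp add: sum_subtractf sum_divide_distrib)
  \<comment> \<open>Each edge of \<open>S\<close> is counted at most twice, so the total loss is at
    most 6 and the average is at least 3|W| - 6, above the bound 3|W| - 7.\<close>
  moreover have "(\<Sum>v\<in>W. card (?T v)) \<le> 12" using sum_card_nbrs_le[OF S(1) fW] S(2) by linarith
  then have "real (\<Sum>v\<in>W. card (?T v)) \<le> 12" using of_nat_mono by fastforce
  ultimately show False by linarith
qed

theorem theorem7p2:
  fixes n :: nat and F S :: "nat set set" and x y :: "nat \<Rightarrow> real"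
  assumes "is_graph n F"
    and "k_connected 12 n F"
    and "S \<subseteq> F" and "card S \<le> 6"
    and "generic_config n x y"
  shows "cof_spans n x y (F - S)"
proof -
  define H where "H = cof_closure n x y (F - S)"
  have F: "F \<subseteq> Kn_edges n" using assms(1) by (simp add: is_graph_def)
  have "F - S \<subseteq> H" unfolding H_def by (rule cof_closure_superset) (use F in blast)
  then have "F \<subseteq> H \<union> S" by blast
  \<comment> \<open>Restoring \<open>S\<close> to the closure gives a supergraph of
    \<open>F\<close>, which inherits its connectivity.\<close>
  then have "k_connected_on 12 {..<n} (H \<union> S)" using assms(2) by (intro k_connected_imp_on)
  then have "clique H {..<n}"
    by (intro cof_closure_complete[OF assms(5) H_def _ assms(4)]) (use F assms(3) in blast)+
  then have "Kn_edges n \<subseteq> H" by (auto simp: clique_def elim!: Kn_edgesE)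
  then show ?thesis using F by (auto simp: cof_spans_def H_def cof_closure_def)
qed

end
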